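(* Let $J$ be a nonselfadjoint Jacobi operator in $l_2(\mathbb{N})$, let $\tilde J$ be a canonical selfadjoint extension of $J$ with spectral measure $E$, and let $\mu(\cdot)=\langle\delta_1,E(\cdot)\delta_1\rangle$, where $\delta_1$ is the first canonical basis vector (so $\mu$ is a solution of an indeterminate Hamburger moment problem). Put $C:=\int_{\mathbb{R}}(1+x^2)^{-1}d\mu(x)$ and $\nu_1(\partial):=\frac1C\int_\partial(1+x^2)^{-1}d\mu(x)$ for Borel sets $\partial\subset\mathbb{R}$. Let $\{R_{k-1}\}_{k=1}^\infty$ be the orthonormal polynomials in $L_2(\mathbb{R},\nu_1)$ obtained by the Gram-Schmidt procedure from the monomials $\{t^{k-1}\}_{k=1}^\infty$, and define $$f_{k-1}(t):=\frac{1}{\sqrt{C}\,(t-i)}R_{k-1}(t),\qquad k\in\mathbb{N}.$$ Then the sequence $\{f_{k-1}\}_{k=1}^\infty$ is an orthonormal basis of $L_2(\mathbb{R},\mu)$ and a basis of representation for the operator $M_\mu$ of multiplication by the independent variable in $L_2(\mathbb{R},\mu)$, considered on its maximal domain.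
   Context: Hilbert spaces are complex; inner products are antilinear in the first argument; $\mathbb{N}=\{1,2,\dots\}$. Jacobi matrix: a semi-infinite tridiagonal matrix with real diagonal entries $q_1,q_2,\dots$ and positive entries $b_1,b_2,\dots$ on both the sub- and superdiagonal, all other entries being zero. The associated Jacobi operator $J$ is the closure in $l_2(\mathbb{N})$ of the operator defined on finitely supported sequences by $(J_0\phi)_1=q_1\phi_1+b_1\phi_2$, $(J_0\phi)_k=b_{k-1}\phi_{k-1}+q_k\phi_k+b_k\phi_{k+1}$ for $k\ge2$. $\{\delta_k\}_{k=1}^\infty$ is the canonical basis of $l_2(\mathbb{N})$. A canonical selfadjoint extension of a symmetric operator is a selfadjoint restriction of its adjoint (equivalently, a selfadjoint extension within the same Hilbert space). Basis of representation: an orthonormal basis $\{u_k\}_{k=1}^\infty$ of a Hilbert space is a basis of representation for a closed operator $A$ if (a) $u_k\in\operatorname{dom}A$ for all $k$, and (b) every closed operator $B$ with $Bu_k=Au_k$ for all $k$ satisfies $B\supset A$. $\operatorname{dom}M_\mu=\{f\in L_2(\mathbb{R},\mu):\int_{\mathbb{R}}t^2|f(t)|^2d\mu(t)<\infty\}$ and $(M_\mu f)(t)=tf(t)$. The Gram-Schmidt procedure applied to the monomials yields orthonormal polynomials $R_k$ of degree $k$ with positive leading coefficient. *)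

theory Defs
  imports "HOL-Analysis.Analysis"
begin

section \<open>Complex L2 spaces and operators in them\<close>

text \<open>
  An element of the Hilbert space of a measure \<open>M\<close> is represented by a square integrable
  function, and two representatives are the same element iff they agree almost everywhere.
  Every notion below respects this identification. An operator is given by its graph, a set of
  pairs of functions that is saturated under almost everywhere equality; inclusion of operators
  is then inclusion of graphs, and the image \<open>A `` {f}\<close> is the class \<open>A f\<close>.
\<close>

definition L2 :: "'a measure \<Rightarrow> ('a \<Rightarrow> complex) set" where
  "L2 M = {f \<in> borel_measurable M. integrable M (\<lambda>x. (cmod (f x))\<^sup>2)}"

definition L2_inner :: "'a measure \<Rightarrow> ('a \<Rightarrow> complex) \<Rightarrow> ('a \<Rightarrow> complex) \<Rightarrow> complex" where
  "L2_inner M f g = (LINT x|M. cnj (f x) * g x)"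

definition L2_norm :: "'a measure \<Rightarrow> ('a \<Rightarrow> complex) \<Rightarrow> real" where
  "L2_norm M f = sqrt (LINT x|M. (cmod (f x))\<^sup>2)"

definition L2_tendsto ::
    "'a measure \<Rightarrow> (nat \<Rightarrow> 'a \<Rightarrow> complex) \<Rightarrow> ('a \<Rightarrow> complex) \<Rightarrow> bool" where
  "L2_tendsto M s f \<longleftrightarrow> (\<lambda>n. L2_norm M (\<lambda>x. s n x - f x)) \<longlonglongrightarrow> 0"

definition orthonormal_basis :: "'a measure \<Rightarrow> (nat \<Rightarrow> 'a \<Rightarrow> complex) \<Rightarrow> bool" where
  "orthonormal_basis M u \<longleftrightarrow>
     (\<forall>k. u k \<in> L2 M) \<and>
     (\<forall>j k. L2_inner M (u j) (u k) = (if j = k then 1 else 0)) \<and>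
     (\<forall>f \<in> L2 M. L2_tendsto M (\<lambda>n x. \<Sum>k<n. L2_inner M (u k) f * u k x) f)"

type_synonym 'a graph = "(('a \<Rightarrow> complex) \<times> ('a \<Rightarrow> complex)) set"

definition linear_op :: "'a measure \<Rightarrow> 'a graph \<Rightarrow> bool" where
  "linear_op M A \<longleftrightarrow>
     A \<subseteq> L2 M \<times> L2 M \<and>
     (\<lambda>_. 0, \<lambda>_. 0) \<in> A \<and>
     (\<forall>f g f' g' c. (f, g) \<in> A \<longrightarrow> (f', g') \<in> A \<longrightarrow>
        (\<lambda>x. c * f x + f' x, \<lambda>x. c * g x + g' x) \<in> A) \<and>
     (\<forall>f g f' g'. (f, g) \<in> A \<longrightarrow> f' \<in> L2 M \<longrightarrow> g' \<in> L2 M \<longrightarrow>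
        (AE x in M. f x = f' x) \<longrightarrow> (AE x in M. g x = g' x) \<longrightarrow> (f', g') \<in> A) \<and>
     (\<forall>f g g'. (f, g) \<in> A \<longrightarrow> (f, g') \<in> A \<longrightarrow> (AE x in M. g x = g' x))"

definition op_closure :: "'a measure \<Rightarrow> 'a graph \<Rightarrow> 'a graph" where
  "op_closure M A = {(f, g). f \<in> L2 M \<and> g \<in> L2 M \<and>
     (\<exists>s r. (\<forall>n. (s n, r n) \<in> A) \<and> L2_tendsto M s f \<and> L2_tendsto M r g)}"

definition closed_op :: "'a measure \<Rightarrow> 'a graph \<Rightarrow> bool" where
  "closed_op M A \<longleftrightarrow> linear_op M A \<and> op_closure M A = A"

definition densely_defined :: "'a measure \<Rightarrow> 'a graph \<Rightarrow> bool" where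
  "densely_defined M A \<longleftrightarrow>
     (\<forall>f \<in> L2 M. \<exists>s. (\<forall>n. s n \<in> Domain A) \<and> L2_tendsto M s f)"

definition op_adjoint :: "'a measure \<Rightarrow> 'a graph \<Rightarrow> 'a graph" where
  "op_adjoint M A = {(f, g). f \<in> L2 M \<and> g \<in> L2 M \<and>
     (\<forall>(u, v) \<in> A. L2_inner M f v = L2_inner M g u)}"

definition selfadjoint :: "'a measure \<Rightarrow> 'a graph \<Rightarrow> bool" where
  "selfadjoint M A \<longleftrightarrow> linear_op M A \<and> densely_defined M A \<and> op_adjoint M A = A"

definition canonical_sa_extension :: "'a measure \<Rightarrow> 'a graph \<Rightarrow> 'a graph \<Rightarrow> bool" where
  "canonical_sa_extension M A B \<longleftrightarrow> selfadjoint M B \<and> B \<subseteq> op_adjoint M A"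

definition basis_of_representation ::
    "'a measure \<Rightarrow> (nat \<Rightarrow> 'a \<Rightarrow> complex) \<Rightarrow> 'a graph \<Rightarrow> bool" where
  "basis_of_representation M u A \<longleftrightarrow>
     orthonormal_basis M u \<and> closed_op M A \<and>
     (\<forall>k. u k \<in> Domain A) \<and>
     (\<forall>B. closed_op M B \<and> (\<forall>k. u k \<in> Domain B \<and> B `` {u k} = A `` {u k}) \<longrightarrow> A \<subseteq> B)"

definition mult_op :: "real measure \<Rightarrow> real graph" where
  "mult_op \<mu> = {(f, g). f \<in> L2 \<mu> \<and> g \<in> L2 \<mu> \<and>
     integrable \<mu> (\<lambda>t. t\<^sup>2 * (cmod (f t))\<^sup>2) \<and>
     (AE t in \<mu>. g t = complex_of_real t * f t)}"

fun gram_schmidt ::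
    "'a measure \<Rightarrow> (nat \<Rightarrow> 'a \<Rightarrow> complex) \<Rightarrow> nat \<Rightarrow> 'a \<Rightarrow> complex" where
  "gram_schmidt M v k =
     (let w = (\<lambda>x. v k x -
        (\<Sum>j<k. L2_inner M (gram_schmidt M v j) (v k) * gram_schmidt M v j x))
      in (\<lambda>x. w x / complex_of_real (L2_norm M w)))"

declare gram_schmidt.simps [simp del]


section \<open>Spectral measures\<close>

definition orth_projection ::
    "'a measure \<Rightarrow> (('a \<Rightarrow> complex) \<Rightarrow> ('a \<Rightarrow> complex)) \<Rightarrow> bool" where
  "orth_projection M P \<longleftrightarrow>
     (\<forall>f \<in> L2 M. P f \<in> L2 M) \<and>
     (\<forall>f \<in> L2 M. \<forall>g \<in> L2 M. \<forall>c.
        AE x in M. P (\<lambda>y. c * f y + g y) x = c * P f x + P g x) \<and>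
     (\<forall>f \<in> L2 M. AE x in M. P (P f) x = P f x) \<and>
     (\<forall>f \<in> L2 M. \<forall>g \<in> L2 M. L2_inner M (P f) g = L2_inner M f (P g))"

definition resolution_of_identity ::
    "'a measure \<Rightarrow> (real set \<Rightarrow> ('a \<Rightarrow> complex) \<Rightarrow> ('a \<Rightarrow> complex)) \<Rightarrow> bool" where
  "resolution_of_identity M E \<longleftrightarrow>
     (\<forall>S \<in> sets borel. orth_projection M (E S)) \<and>
     (\<forall>f \<in> L2 M. AE x in M. E UNIV f x = f x) \<and>
     (\<forall>S \<in> sets borel. \<forall>T \<in> sets borel. \<forall>f \<in> L2 M.
        AE x in M. E (S \<inter> T) f x = E S (E T f) x) \<and>
     (\<forall>S. range S \<subseteq> sets borel \<longrightarrow> disjoint_family S \<longrightarrow>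
        (\<forall>f \<in> L2 M. \<forall>g \<in> L2 M.
           (\<lambda>n::nat. L2_inner M g (E (S n) f)) sums L2_inner M g (E (\<Union>n. S n) f)))"

text \<open>
  The Borel measure that sends \<open>S\<close> to the inner product of \<open>f\<close> with \<open>E(S) f\<close>. This number is
  real and nonnegative since \<open>E(S)\<close> is an orthogonal projection, so that taking real parts
  loses nothing; see \<open>emeasure_spectral_dist\<close> below.
\<close>

definition spectral_dist ::
    "'a measure \<Rightarrow> (real set \<Rightarrow> ('a \<Rightarrow> complex) \<Rightarrow> ('a \<Rightarrow> complex)) \<Rightarrow> ('a \<Rightarrow> complex)
      \<Rightarrow> real measure" where
  "spectral_dist M E f =
     measure_of UNIV (sets borel) (\<lambda>S. ennreal (Re (L2_inner M f (E S f))))"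

text \<open>
  The operator given by the spectral integral of \<open>t\<close> against \<open>E\<close>. Its domain consists of the
  \<open>f\<close> for which \<open>t\<close> is square integrable with respect to the scalar spectral measure of \<open>f\<close>,
  and its value at \<open>f\<close> is the norm limit of the integrals of simple functions that
  converge to \<open>t\<close> in the mean square of that scalar measure.
\<close>

definition spectral_integral ::
    "'a measure \<Rightarrow> (real set \<Rightarrow> ('a \<Rightarrow> complex) \<Rightarrow> ('a \<Rightarrow> complex)) \<Rightarrow> 'a graph" where
  "spectral_integral M E = {(f, g). f \<in> L2 M \<and> g \<in> L2 M \<and>
     integrable (spectral_dist M E f) (\<lambda>t. t\<^sup>2) \<and>
     (\<exists>s :: nat \<Rightarrow> real \<Rightarrow> real.
        (\<forall>n. simple_function borel (s n)) \<and>
        (\<lambda>n. \<integral>\<^sup>+t. ennreal ((s n t - t)\<^sup>2) \<partial>spectral_dist M E f) \<longlonglongrightarrow> 0 \<and>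
        L2_tendsto M (\<lambda>n x. \<Sum>c\<in>range (s n). complex_of_real c * E (s n -` {c}) f x) g)}"

definition is_spectral_measure ::
    "'a measure \<Rightarrow> 'a graph \<Rightarrow> (real set \<Rightarrow> ('a \<Rightarrow> complex) \<Rightarrow> ('a \<Rightarrow> complex)) \<Rightarrow> bool" where
  "is_spectral_measure M A E \<longleftrightarrow> resolution_of_identity M E \<and> A = spectral_integral M E"


section \<open>Jacobi operators\<close>

text \<open>
  Sequences are indexed from 0: entry \<open>k\<close> here is entry \<open>k + 1\<close> of a sequence indexed by the
  positive integers. The space of square summable sequences is the L2 space of the counting
  measure on \<open>nat\<close>, where almost everywhere equality is equality.
\<close>

abbreviation cnt :: "nat measure" where
  "cnt \<equiv> count_space UNIV"

definition delta :: "nat \<Rightarrow> nat \<Rightarrow> complex" where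
  "delta k = (\<lambda>j. if j = k then 1 else 0)"

definition jacobi_apply ::
    "(nat \<Rightarrow> real) \<Rightarrow> (nat \<Rightarrow> real) \<Rightarrow> (nat \<Rightarrow> complex) \<Rightarrow> (nat \<Rightarrow> complex)" where
  "jacobi_apply q b \<phi> = (\<lambda>k.
     (if k = 0 then 0 else complex_of_real (b (k - 1)) * \<phi> (k - 1))
     + complex_of_real (q k) * \<phi> k + complex_of_real (b k) * \<phi> (k + 1))"

definition jacobi_operator :: "(nat \<Rightarrow> real) \<Rightarrow> (nat \<Rightarrow> real) \<Rightarrow> nat graph" where
  "jacobi_operator q b =
     op_closure cnt {(\<phi>, jacobi_apply q b \<phi>) | \<phi>. finite {k. \<phi> k \<noteq> 0}}"


section \<open>Consistency of the encoding\<close>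

lemma L2_cnt_iff: "f \<in> L2 cnt \<longleftrightarrow> summable (\<lambda>k. (cmod (f k))\<^sup>2)"
  by (simp add: L2_def integrable_count_space_nat_iff)

lemma sets_spectral_dist [simp]: "sets (spectral_dist M E f) = sets borel"
  unfolding spectral_dist_def
  by (metis sets.sigma_sets_eq sets_measure_of space_borel sets.space_closed)

lemma space_spectral_dist [simp]: "space (spectral_dist M E f) = UNIV"
  unfolding spectral_dist_def
  by (metis space_measure_of space_borel sets.space_closed)

lemma L2_inner_projection:
  assumes P: "orth_projection M P" and f: "f \<in> L2 M"
  shows "L2_inner M f (P f) = complex_of_real ((L2_norm M (P f))\<^sup>2)"
proof -
  have Pf: "P f \<in> L2 M" and PPf: "AE x in M. P (P f) x = P f x"
    using P f by (auto simp: orth_projection_def)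
  have PPL: "P (P f) \<in> L2 M" using P Pf by (auto simp: orth_projection_def)
  have m: "f \<in> borel_measurable M" "P f \<in> borel_measurable M" "P (P f) \<in> borel_measurable M"
    using f Pf PPL by (auto simp: L2_def)
  have cnj_m: "(\<lambda>x. cnj (f x)) \<in> borel_measurable M"
    using m(1) by (rule borel_measurable_continuous_on[OF continuous_on_cnj[OF continuous_on_id]])
  have "L2_inner M f (P f) = L2_inner M f (P (P f))"
    unfolding L2_inner_def using PPf m cnj_m by (intro integral_cong_AE) auto
  also have "\<dots> = L2_inner M (P f) (P f)"
    using P f Pf by (auto simp: orth_projection_def)
  also have "\<dots> = (LINT x|M. complex_of_real ((cmod (P f x))\<^sup>2))"
    unfolding L2_inner_def
    by (intro Bochner_Integration.integral_cong)
       (auto simp: complex_norm_square mult.commute simp del: of_real_power)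
  also have "\<dots> = complex_of_real (LINT x|M. (cmod (P f x))\<^sup>2)"
    by (rule integral_complex_of_real)
  finally show ?thesis
    by (simp add: L2_norm_def)
qed

lemma emeasure_spectral_dist:
  assumes E: "resolution_of_identity M E" and f: "f \<in> L2 M" and S: "S \<in> sets borel"
  shows "emeasure (spectral_dist M E f) S = ennreal (Re (L2_inner M f (E S f)))"
    and "L2_inner M f (E S f) = complex_of_real (Re (L2_inner M f (E S f)))"
    and "0 \<le> Re (L2_inner M f (E S f))"
proof -
  have eq: "L2_inner M f (E T f) = complex_of_real ((L2_norm M (E T f))\<^sup>2)"
    if "T \<in> sets borel" for T
    using E f that by (intro L2_inner_projection) (auto simp: resolution_of_identity_def)
  have ge: "0 \<le> Re (L2_inner M f (E T f))" if "T \<in> sets borel" for T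
    using eq[OF that] by simp
  show "L2_inner M f (E S f) = complex_of_real (Re (L2_inner M f (E S f)))"
    using eq[OF S] by simp
  show "0 \<le> Re (L2_inner M f (E S f))"
    using ge[OF S] .
  let ?m = "\<lambda>T. ennreal (Re (L2_inner M f (E T f)))"
  have add: "(\<lambda>n::nat. L2_inner M f (E (T n) f)) sums L2_inner M f (E (\<Union>n. T n) f)"
    if "range T \<subseteq> sets borel" "disjoint_family T" for T
    using E f that by (auto simp: resolution_of_identity_def)
  have "(\<lambda>n::nat. L2_inner M f (E {} f)) sums L2_inner M f (E {} f)"
    using add[of "\<lambda>_. {}"] by (auto simp: disjoint_family_on_def)
  then have "(\<lambda>n::nat. L2_inner M f (E {} f)) \<longlonglongrightarrow> 0"
    by (intro summable_LIMSEQ_zero) (rule sums_summable)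
  then have zero: "L2_inner M f (E {} f) = 0"
    by (simp add: LIMSEQ_const_iff)
  show "emeasure (spectral_dist M E f) S = ?m S"
  proof (rule emeasure_measure_of[OF spectral_dist_def])
    show "sets (borel :: real measure) \<subseteq> Pow UNIV" by simp
    show "S \<in> sets (spectral_dist M E f)" using S by simp
    show "positive (sets (spectral_dist M E f)) ?m"
      using zero by (simp add: positive_def)
    show "countably_additive (sets (spectral_dist M E f)) ?m"
      unfolding countably_additive_def
    proof (intro allI impI)
      fix T :: "nat \<Rightarrow> real set"
      assume "range T \<subseteq> sets (spectral_dist M E f)" and d: "disjoint_family T"
      then have r: "range T \<subseteq> sets borel" by simp
      have "(\<lambda>n. Re (L2_inner M f (E (T n) f))) sums Re (L2_inner M f (E (\<Union>n. T n) f))"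
        by (rule sums_Re) (rule add[OF r d])
      then show "(\<Sum>n. ?m (T n)) = ?m (\<Union>n. T n)"
        using ge r by (intro suminf_ennreal_eq) auto
    qed
  qed
qed

end

theory Submission
  imports Defs
begin

text \<open>
  Let \<open>A\<close> be the selfadjoint extension and \<open>p\<close> a polynomial. The identity
  \<open>p(A) \<delta>\<^sub>0 = p(J) \<delta>\<^sub>0\<close> and the spectral calculus make \<open>p \<mapsto> p(J) \<delta>\<^sub>0\<close> isometric from
  \<open>L\<^sub>2(\<mu>)\<close> to \<open>l\<^sub>2\<close>, and the distance of the indicator of \<open>S\<close> to \<open>p\<close> in \<open>L\<^sub>2(\<mu>)\<close> is the distance of
  \<open>E(S) \<delta>\<^sub>0\<close> to \<open>p(J) \<delta>\<^sub>0\<close>. As the offdiagonal entries do not vanish, the vectors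
  \<open>p(J) \<delta>\<^sub>0\<close> are exactly the finitely supported ones, so polynomials are dense in \<open>L\<^sub>2(\<mu>)\<close>.
  Multiplication by \<open>1 / (\<surd>C (t - i))\<close> is isometric from \<open>L\<^sub>2(\<nu>)\<close> to \<open>L\<^sub>2(\<mu>)\<close> and carries \<open>R\<^sub>k\<close> to
  \<open>f\<^sub>k\<close>, so the \<open>f\<^sub>k\<close> are orthonormal with linear span \<open>{p / (t - i)}\<close>. The operator \<open>M - i\<close>
  maps this span onto the polynomials, which are dense, and its inverse is bounded; hence the span
  is a core of \<open>M\<close>, and in particular it is dense.
\<close>

subsection \<open>Square integrable functions\<close>

lemma borel_measurable_cnj' [measurable (raw)]:
  "f \<in> borel_measurable M \<Longrightarrow> (\<lambda>x. cnj (f x)) \<in> borel_measurable M"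
  by (rule borel_measurable_continuous_on[OF continuous_on_cnj[OF continuous_on_id]])

lemma L2_measurable: "f \<in> L2 M \<Longrightarrow> f \<in> borel_measurable M"
  by (simp add: L2_def)

lemma L2_integrable: "f \<in> L2 M \<Longrightarrow> integrable M (\<lambda>x. (cmod (f x))\<^sup>2)"
  by (simp add: L2_def)

lemma L2_bound:
  assumes "f \<in> L2 M" "g \<in> borel_measurable M" "\<And>x. x \<in> space M \<Longrightarrow> cmod (g x) \<le> C * cmod (f x)"
  shows "g \<in> L2 M"
proof -
  have "(cmod (g x))\<^sup>2 \<le> C\<^sup>2 * (cmod (f x))\<^sup>2" if "x \<in> space M" for x
    using power_mono[OF assms(3)[OF that], of 2] by (simp add: power_mult_distrib)
  then have "integrable M (\<lambda>x. (cmod (g x))\<^sup>2)"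
    using assms(2) by (intro Bochner_Integration.integrable_bound[OF integrable_mult_right[OF L2_integrable[OF assms(1)], of "C\<^sup>2"]]) auto
  then show ?thesis
    using assms(2) by (simp add: L2_def)
qed

lemma L2_cmult: "f \<in> L2 M \<Longrightarrow> (\<lambda>x. c * f x) \<in> L2 M"
  by (rule L2_bound[where C = "cmod c"]) (auto simp: norm_mult L2_def)

lemma norm_add_power2_le: "(norm (x + y))\<^sup>2 \<le> 2 * (norm x)\<^sup>2 + 2 * (norm (y :: 'a :: real_normed_vector))\<^sup>2"
proof -
  have "(norm (x + y))\<^sup>2 \<le> (norm x + norm y)\<^sup>2"
    by (intro power_mono norm_triangle_ineq) auto
  also have "\<dots> \<le> 2 * (norm x)\<^sup>2 + 2 * (norm y)\<^sup>2"
    using zero_le_power2[of "norm x - norm y"] by (simp add: power2_eq_square algebra_simps)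
  finally show ?thesis .
qed

lemma L2_add: "f \<in> L2 M \<Longrightarrow> g \<in> L2 M \<Longrightarrow> (\<lambda>x. f x + g x) \<in> L2 M"
proof -
  assume f: "f \<in> L2 M" and g: "g \<in> L2 M"
  have [measurable]: "f \<in> borel_measurable M" "g \<in> borel_measurable M"
    using f g by (auto dest: L2_measurable)
  have "integrable M (\<lambda>x. (cmod (f x + g x))\<^sup>2)"
  proof (rule Bochner_Integration.integrable_bound)
    show "integrable M (\<lambda>x. 2 * (cmod (f x))\<^sup>2 + 2 * (cmod (g x))\<^sup>2)"
      using f g by (intro Bochner_Integration.integrable_add integrable_mult_right L2_integrable)
  qed (auto simp: norm_add_power2_le)
  then show ?thesis by (simp add: L2_def)
qed

lemma L2_minus: "f \<in> L2 M \<Longrightarrow> (\<lambda>x. - f x) \<in> L2 M"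
  using L2_cmult[of f M "-1"] by simp

lemma L2_diff: "f \<in> L2 M \<Longrightarrow> g \<in> L2 M \<Longrightarrow> (\<lambda>x. f x - g x) \<in> L2 M"
  using L2_add[OF _ L2_minus, of f M g] by simp

lemma L2_zero [simp]: "(\<lambda>_. 0) \<in> L2 M"
  by (simp add: L2_def)

lemma L2_sum: "(\<And>i. i \<in> I \<Longrightarrow> f i \<in> L2 M) \<Longrightarrow> (\<lambda>x. \<Sum>i\<in>I. f i x) \<in> L2 M"
  by (induction I rule: infinite_finite_induct) (auto intro: L2_add)

lemma L2_indicator_mult:
  "f \<in> L2 M \<Longrightarrow> S \<in> sets M \<Longrightarrow> (\<lambda>x. indicator S x * f x) \<in> L2 M"
  by (rule L2_bound[where C = 1]) (auto simp: L2_def norm_mult indicator_def)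

lemma integrable_L2_mult:
  assumes "f \<in> L2 M" "g \<in> L2 M"
  shows "integrable M (\<lambda>x. f x * g x)"
proof (rule Bochner_Integration.integrable_bound)
  show "integrable M (\<lambda>x. (cmod (f x))\<^sup>2 + (cmod (g x))\<^sup>2)"
    using assms by (auto dest: L2_integrable)
  have "cmod (f x) * cmod (g x) \<le> (cmod (f x))\<^sup>2 + (cmod (g x))\<^sup>2" for x
    using sum_squares_bound[of "cmod (f x)" "cmod (g x)"] zero_le_power2[of "cmod (f x)"] zero_le_power2[of "cmod (g x)"]
      mult_nonneg_nonneg[of "cmod (f x)" "cmod (g x)"] by linarith
  then show "AE x in M. norm (f x * g x) \<le> norm ((cmod (f x))\<^sup>2 + (cmod (g x))\<^sup>2)"
    by (auto simp: norm_mult)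
qed (use assms in \<open>auto simp: L2_def\<close>)

lemma L2_cnj: "f \<in> L2 M \<Longrightarrow> (\<lambda>x. cnj (f x)) \<in> L2 M"
  by (rule L2_bound[where C = 1]) (auto simp: L2_def)

lemma integrable_L2_inner: "f \<in> L2 M \<Longrightarrow> g \<in> L2 M \<Longrightarrow> integrable M (\<lambda>x. cnj (f x) * g x)"
  by (intro integrable_L2_mult L2_cnj)

section \<open>Sesquilinearity of the inner product\<close>

lemma L2_inner_add_right:
  "f \<in> L2 M \<Longrightarrow> g \<in> L2 M \<Longrightarrow> h \<in> L2 M \<Longrightarrow>
    L2_inner M f (\<lambda>x. g x + h x) = L2_inner M f g + L2_inner M f h"
  by (simp add: L2_inner_def distrib_left integrable_L2_inner)

lemma L2_inner_cmult_right: "L2_inner M f (\<lambda>x. c * g x) = c * L2_inner M f g"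
  unfolding L2_inner_def by (subst integral_mult_right_zero[symmetric]) (simp add: mult.left_commute)

lemma L2_inner_commute: "L2_inner M g f = cnj (L2_inner M f g)"
  unfolding L2_inner_def by (subst Bochner_Integration.integral_cnj[symmetric]) (simp add: mult.commute)

lemma L2_inner_cmult_left: "L2_inner M (\<lambda>x. c * f x) g = cnj c * L2_inner M f g"
  by (subst (1 2) L2_inner_commute) (simp add: L2_inner_cmult_right)

lemma L2_inner_add_left:
  "f \<in> L2 M \<Longrightarrow> g \<in> L2 M \<Longrightarrow> h \<in> L2 M \<Longrightarrow>
    L2_inner M (\<lambda>x. f x + g x) h = L2_inner M f h + L2_inner M g h"
  by (subst (1 2 3) L2_inner_commute) (simp add: L2_inner_add_right)

lemma L2_inner_zero [simp]: "L2_inner M (\<lambda>_. 0) f = 0" "L2_inner M f (\<lambda>_. 0) = 0"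
  by (simp_all add: L2_inner_def)

lemma L2_inner_diff_right:
  "f \<in> L2 M \<Longrightarrow> g \<in> L2 M \<Longrightarrow> h \<in> L2 M \<Longrightarrow>
    L2_inner M f (\<lambda>x. g x - h x) = L2_inner M f g - L2_inner M f h"
  using L2_inner_add_right[of f M g "\<lambda>x. -1 * h x"] L2_inner_cmult_right[of M f "-1" h] L2_minus[of h M] by simp

lemma L2_inner_diff_left:
  "f \<in> L2 M \<Longrightarrow> g \<in> L2 M \<Longrightarrow> h \<in> L2 M \<Longrightarrow>
    L2_inner M (\<lambda>x. f x - g x) h = L2_inner M f h - L2_inner M g h"
  by (subst (1 2 3) L2_inner_commute) (simp add: L2_inner_diff_right)

lemma L2_inner_sum_right:
  "f \<in> L2 M \<Longrightarrow> (\<And>i. i \<in> I \<Longrightarrow> g i \<in> L2 M) \<Longrightarrow>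
    L2_inner M f (\<lambda>x. \<Sum>i\<in>I. g i x) = (\<Sum>i\<in>I. L2_inner M f (g i))"
  by (induction I rule: infinite_finite_induct) (auto simp: L2_inner_add_right L2_sum)

lemma L2_inner_sum_left:
  "f \<in> L2 M \<Longrightarrow> (\<And>i. i \<in> I \<Longrightarrow> g i \<in> L2 M) \<Longrightarrow>
    L2_inner M (\<lambda>x. \<Sum>i\<in>I. g i x) f = (\<Sum>i\<in>I. L2_inner M (g i) f)"
  by (subst L2_inner_commute, subst L2_inner_sum_right, auto) (auto intro!: sum.cong L2_inner_commute[symmetric])

lemma L2_inner_cong_AE:
  assumes "f \<in> L2 M" "g \<in> L2 M" "f' \<in> L2 M" "g' \<in> L2 M"
    and "AE x in M. f x = f' x" "AE x in M. g x = g' x"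
  shows "L2_inner M f g = L2_inner M f' g'"
  unfolding L2_inner_def
proof (rule integral_cong_AE)
  show "AE x in M. cnj (f x) * g x = cnj (f' x) * g' x"
    using assms(5,6) by eventually_elim simp
qed (use assms in \<open>auto intro!: borel_measurable_times borel_measurable_cnj' dest: L2_measurable\<close>)

section \<open>Norm, Cauchy-Schwarz inequality and triangle inequality\<close>

lemma L2_inner_self: "L2_inner M f f = complex_of_real ((L2_norm M f)\<^sup>2)"
proof -
  have "L2_inner M f f = (LINT x|M. complex_of_real ((cmod (f x))\<^sup>2))"
    unfolding L2_inner_def
    by (intro Bochner_Integration.integral_cong)
       (auto simp: complex_norm_square mult.commute simp del: of_real_power)
  also have "\<dots> = complex_of_real (LINT x|M. (cmod (f x))\<^sup>2)"
    by (rule integral_complex_of_real)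
  finally show ?thesis
    by (simp add: L2_norm_def)
qed

lemma L2_norm_nonneg [simp]: "0 \<le> L2_norm M f"
  by (simp add: L2_norm_def)

lemma L2_norm_zero [simp]: "L2_norm M (\<lambda>_. 0) = 0"
  by (simp add: L2_norm_def)

lemma L2_norm_power2: "(L2_norm M f)\<^sup>2 = (LINT x|M. (cmod (f x))\<^sup>2)"
  by (simp add: L2_norm_def)

lemma L2_norm_cong_AE:
  assumes "f \<in> borel_measurable M" "g \<in> borel_measurable M" "AE x in M. f x = g x"
  shows "L2_norm M f = L2_norm M g"
  unfolding L2_norm_def using assms by (intro arg_cong[where f = sqrt] integral_cong_AE) auto

lemma L2_norm_mono:
  assumes "g \<in> L2 M" "f \<in> borel_measurable M" "\<And>x. x \<in> space M \<Longrightarrow> cmod (f x) \<le> cmod (g x)"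
  shows "L2_norm M f \<le> L2_norm M g"
  unfolding L2_norm_def
  by (intro real_sqrt_le_mono integral_mono L2_integrable power_mono L2_bound[where C = 1 and g = f] assms)
     (use assms in auto)

lemma L2_norm_eq_0_iff:
  assumes "f \<in> L2 M"
  shows "L2_norm M f = 0 \<longleftrightarrow> (AE x in M. f x = 0)"
  unfolding L2_norm_def using integral_nonneg_eq_0_iff_AE[OF L2_integrable[OF assms]] by simp

lemma L2_norm_cmult: "L2_norm M (\<lambda>x. c * f x) = cmod c * L2_norm M f"
  by (simp add: L2_norm_def norm_mult power_mult_distrib real_sqrt_mult)

lemma L2_norm_minus_commute: "L2_norm M (\<lambda>x. f x - g x) = L2_norm M (\<lambda>x. g x - f x)"
  by (simp add: L2_norm_def norm_minus_commute)

lemma ennreal_L2_norm_power2: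
  assumes "f \<in> L2 M"
  shows "ennreal ((L2_norm M f)\<^sup>2) = (\<integral>\<^sup>+x. ennreal ((cmod (f x))\<^sup>2) \<partial>M)"
  using nn_integral_eq_integral[OF L2_integrable[OF assms]] by (simp add: L2_norm_power2)

text \<open>Moving the absolute value inside the integral reduces the claim to the Cauchy-Schwarz
  inequality for nonnegative extended integrals; square integrability makes its right-hand side a
  finite real number.\<close>

lemma L2_Cauchy_Schwarz:
  assumes f: "f \<in> L2 M" and g: "g \<in> L2 M"
  shows "cmod (L2_inner M f g) \<le> L2_norm M f * L2_norm M g"
proof -
  have [measurable]: "f \<in> borel_measurable M" "g \<in> borel_measurable M"
    using f g by (auto dest: L2_measurable)
  have "ennreal (cmod (L2_inner M f g)) \<le> (\<integral>\<^sup>+x. ennreal (cmod (cnj (f x) * g x)) \<partial>M)"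
    unfolding L2_inner_def by (rule integral_norm_bound_ennreal) (rule integrable_L2_inner[OF f g])
  also have "\<dots> = (\<integral>\<^sup>+x. ennreal (cmod (f x)) * ennreal (cmod (g x)) \<partial>M)"
    by (simp add: norm_mult ennreal_mult)
  finally have "(ennreal (cmod (L2_inner M f g)))\<^sup>2 \<le> (\<integral>\<^sup>+x. ennreal (cmod (f x)) * ennreal (cmod (g x)) \<partial>M)\<^sup>2"
    by (rule power_mono) simp
  also have "\<dots> \<le> (\<integral>\<^sup>+x. (ennreal (cmod (f x)))\<^sup>2 \<partial>M) * (\<integral>\<^sup>+x. (ennreal (cmod (g x)))\<^sup>2 \<partial>M)"
    by (rule Cauchy_Schwarz_nn_integral) auto
  also have "\<dots> = ennreal ((L2_norm M f * L2_norm M g)\<^sup>2)"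
    unfolding power_mult_distrib by (subst ennreal_mult) (simp_all add: ennreal_L2_norm_power2 f g ennreal_power)
  finally have "(cmod (L2_inner M f g))\<^sup>2 \<le> (L2_norm M f * L2_norm M g)\<^sup>2"
    by (simp add: ennreal_power)
  then show ?thesis
    by (rule power2_le_imp_le) simp
qed

lemma L2_norm_add_power2:
  assumes "f \<in> L2 M" "g \<in> L2 M"
  shows "(L2_norm M (\<lambda>x. f x + g x))\<^sup>2 = (L2_norm M f)\<^sup>2 + 2 * Re (L2_inner M f g) + (L2_norm M g)\<^sup>2"
proof -
  have "complex_of_real ((L2_norm M (\<lambda>x. f x + g x))\<^sup>2) =
      L2_inner M f f + (L2_inner M f g + cnj (L2_inner M f g)) + L2_inner M g g"
    unfolding L2_inner_self[symmetric]
    using assms by (simp add: L2_inner_add_left L2_inner_add_right L2_add L2_inner_commute[of M g f])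
  also have "\<dots> = complex_of_real ((L2_norm M f)\<^sup>2 + 2 * Re (L2_inner M f g) + (L2_norm M g)\<^sup>2)"
    by (simp add: L2_inner_self complex_add_cnj)
  finally show ?thesis
    by (simp only: of_real_eq_iff)
qed

lemma L2_norm_diff_power2:
  assumes "f \<in> L2 M" "g \<in> L2 M"
  shows "(L2_norm M (\<lambda>x. f x - g x))\<^sup>2 = (L2_norm M f)\<^sup>2 - 2 * Re (L2_inner M f g) + (L2_norm M g)\<^sup>2"
  using L2_norm_add_power2[OF assms(1) L2_minus[OF assms(2)]] L2_inner_cmult_right[of M f "-1" g]
    L2_norm_cmult[of M "-1" g] by simp

lemma L2_norm_triangle:
  assumes "f \<in> L2 M" "g \<in> L2 M"
  shows "L2_norm M (\<lambda>x. f x + g x) \<le> L2_norm M f + L2_norm M g"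
proof (rule power2_le_imp_le)
  have "Re (L2_inner M f g) \<le> L2_norm M f * L2_norm M g"
    using L2_Cauchy_Schwarz[OF assms] complex_Re_le_cmod[of "L2_inner M f g"] by linarith
  then show "(L2_norm M (\<lambda>x. f x + g x))\<^sup>2 \<le> (L2_norm M f + L2_norm M g)\<^sup>2"
    unfolding L2_norm_add_power2[OF assms] power2_sum by linarith
qed simp

lemma L2_norm_triangle_diff:
  assumes "f \<in> L2 M" "g \<in> L2 M" "h \<in> L2 M"
  shows "L2_norm M (\<lambda>x. f x - h x) \<le> L2_norm M (\<lambda>x. f x - g x) + L2_norm M (\<lambda>x. g x - h x)"
  using L2_norm_triangle[OF L2_diff[OF assms(1,2)] L2_diff[OF assms(2,3)]] by simp

section \<open>Convergence in mean square\<close>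

lemma L2_tendstoI_bound:
  assumes "\<And>n. L2_norm M (\<lambda>x. s n x - f x) \<le> e n" "e \<longlonglongrightarrow> 0"
  shows "L2_tendsto M s f"
  unfolding L2_tendsto_def
  by (rule tendsto_sandwich[OF _ _ tendsto_const assms(2)]) (auto intro!: always_eventually assms(1))

lemma L2_tendsto_const: "L2_tendsto M (\<lambda>_. f) f"
  by (simp add: L2_tendsto_def)

lemma L2_tendsto_norm:
  assumes s: "\<And>n. s n \<in> L2 M" and f: "f \<in> L2 M" and lim: "L2_tendsto M s f"
  shows "(\<lambda>n. L2_norm M (s n)) \<longlonglongrightarrow> L2_norm M f"
proof -
  have "norm (L2_norm M (s n) - L2_norm M f) \<le> L2_norm M (\<lambda>x. s n x - f x)" for n
  proof -
    have "L2_norm M (s n) \<le> L2_norm M (\<lambda>x. s n x - f x) + L2_norm M f"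
      using L2_norm_triangle[OF L2_diff[OF s[of n] f] f] by simp
    moreover have "L2_norm M f \<le> L2_norm M (\<lambda>x. s n x - f x) + L2_norm M (s n)"
      using L2_norm_triangle[OF L2_diff[OF f s[of n]] s[of n]] L2_norm_minus_commute[of M f "s n"] by simp
    ultimately show ?thesis by (simp add: abs_le_iff)
  qed
  then have "(\<lambda>n. L2_norm M (s n) - L2_norm M f) \<longlonglongrightarrow> 0"
    by (intro Lim_null_comparison[OF _ lim[unfolded L2_tendsto_def]] always_eventually allI)
  then show ?thesis by (rule LIM_zero_cancel)
qed

text \<open>Write the difference as <s - f, r> + <f, r - g> and bound both terms by Cauchy-Schwarz;
  the norms of \<open>r n\<close> stay bounded because they converge.\<close>

lemma L2_tendsto_inner:
  assumes s: "\<And>n. s n \<in> L2 M" and f: "f \<in> L2 M" and lim: "L2_tendsto M s f"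
    and r: "\<And>n. r n \<in> L2 M" and g: "g \<in> L2 M" and lim': "L2_tendsto M r g"
  shows "(\<lambda>n. L2_inner M (s n) (r n)) \<longlonglongrightarrow> L2_inner M f g"
proof (rule LIM_zero_cancel, rule Lim_null_comparison)
  show "\<forall>\<^sub>F n in sequentially. norm (L2_inner M (s n) (r n) - L2_inner M f g) \<le>
      L2_norm M (\<lambda>x. s n x - f x) * L2_norm M (r n) + L2_norm M f * L2_norm M (\<lambda>x. r n x - g x)"
  proof (intro always_eventually allI)
    fix n
    have "L2_inner M (s n) (r n) - L2_inner M f g =
        L2_inner M (\<lambda>x. s n x - f x) (r n) + L2_inner M f (\<lambda>x. r n x - g x)"
      by (simp add: L2_inner_diff_left[OF s f r] L2_inner_diff_right[OF f r g])
    then show "norm (L2_inner M (s n) (r n) - L2_inner M f g) \<le>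
      L2_norm M (\<lambda>x. s n x - f x) * L2_norm M (r n) + L2_norm M f * L2_norm M (\<lambda>x. r n x - g x)"
      using L2_Cauchy_Schwarz[OF L2_diff[OF s[of n] f] r[of n]] L2_Cauchy_Schwarz[OF f L2_diff[OF r[of n] g]]
      by (metis (no_types, lifting) add_mono norm_triangle_le)
  qed
  have "(\<lambda>n. L2_norm M (\<lambda>x. s n x - f x) * L2_norm M (r n) + L2_norm M f * L2_norm M (\<lambda>x. r n x - g x))
      \<longlonglongrightarrow> 0 * L2_norm M g + L2_norm M f * 0"
    by (intro tendsto_add tendsto_mult tendsto_const L2_tendsto_norm[OF r g lim'] lim[unfolded L2_tendsto_def]
        lim'[unfolded L2_tendsto_def])
  then show "(\<lambda>n. L2_norm M (\<lambda>x. s n x - f x) * L2_norm M (r n) + L2_norm M f * L2_norm M (\<lambda>x. r n x - g x))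
      \<longlonglongrightarrow> 0" by simp
qed

lemma L2_tendsto_indicator_mult:
  assumes "\<And>n. s n \<in> L2 M" "f \<in> L2 M" "L2_tendsto M s f" "S \<in> sets M"
  shows "L2_tendsto M (\<lambda>n x. indicator S x * s n x) (\<lambda>x. indicator S x * f x)"
proof (rule L2_tendstoI_bound)
  show "L2_norm M (\<lambda>x. indicator S x * s n x - indicator S x * f x) \<le> L2_norm M (\<lambda>x. s n x - f x)" for n
  proof (rule L2_norm_mono)
    show "(\<lambda>x. indicator S x * s n x - indicator S x * f x) \<in> borel_measurable M"
      by (intro L2_measurable L2_diff L2_indicator_mult assms)
  qed (auto intro!: L2_diff assms simp: indicator_def)
  show "(\<lambda>n. L2_norm M (\<lambda>x. s n x - f x)) \<longlonglongrightarrow> 0"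
    using assms(3) by (simp add: L2_tendsto_def)
qed

text \<open>Dominated convergence for |s - f|^2 with majorant (C + 1)^2 |f|^2. The factor
  \<open>C\<close> serves both the approximation by simple functions, where it is 2, and
  truncations, where it is 1.\<close>

lemma L2_tendsto_dominated:
  assumes meas: "\<And>n. s n \<in> borel_measurable M" and f: "f \<in> L2 M"
    and lim: "\<And>x. x \<in> space M \<Longrightarrow> (\<lambda>n. s n x) \<longlonglongrightarrow> f x"
    and bound: "\<And>n x. x \<in> space M \<Longrightarrow> cmod (s n x) \<le> C * cmod (f x)"
  shows "L2_tendsto M s f"
proof -
  have [measurable]: "f \<in> borel_measurable M" "\<And>n. s n \<in> borel_measurable M"
    using f meas by (auto dest: L2_measurable)
  have "(\<lambda>n. LINT x|M. (cmod (s n x - f x))\<^sup>2) \<longlonglongrightarrow> (LINT x|M. 0)"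
  proof (rule integral_dominated_convergence)
    show "integrable M (\<lambda>x. (C + 1)\<^sup>2 * (cmod (f x))\<^sup>2)"
      using f by (intro integrable_mult_right L2_integrable)
    show "AE x in M. (\<lambda>n. (cmod (s n x - f x))\<^sup>2) \<longlonglongrightarrow> 0"
    proof (rule AE_I2)
      fix x assume "x \<in> space M"
      then have "(\<lambda>n. (cmod (s n x - f x))\<^sup>2) \<longlonglongrightarrow> (cmod (f x - f x))\<^sup>2"
        by (intro tendsto_intros lim)
      then show "(\<lambda>n. (cmod (s n x - f x))\<^sup>2) \<longlonglongrightarrow> 0" by simp
    qed
    show "AE x in M. norm ((cmod (s n x - f x))\<^sup>2) \<le> (C + 1)\<^sup>2 * (cmod (f x))\<^sup>2" for n
    proof (rule AE_I2)
      fix x assume "x \<in> space M"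
      then have "cmod (s n x - f x) \<le> (C + 1) * cmod (f x)"
        using bound[of x n] norm_triangle_ineq4[of "s n x" "f x"] by (simp add: algebra_simps)
      from power_mono[OF this, of 2] show "norm ((cmod (s n x - f x))\<^sup>2) \<le> (C + 1)\<^sup>2 * (cmod (f x))\<^sup>2"
        by (simp add: power_mult_distrib)
    qed
  qed auto
  from tendsto_real_sqrt[OF this] show ?thesis
    by (simp add: L2_tendsto_def L2_norm_def)
qed

subsection \<open>Subspaces, Fourier expansions and the Gram--Schmidt procedure\<close>

text \<open>The norm closure is put in epsilon form so that each approximant can be found
  separately, without building a sequence.\<close>

definition L2_closure :: "'a measure \<Rightarrow> ('a \<Rightarrow> complex) set \<Rightarrow> ('a \<Rightarrow> complex) set" where
  "L2_closure M V = {f \<in> L2 M. \<forall>\<epsilon>>0. \<exists>g\<in>V. L2_norm M (\<lambda>x. f x - g x) < \<epsilon>}"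

definition L2_subspace :: "'a measure \<Rightarrow> ('a \<Rightarrow> complex) set \<Rightarrow> bool" where
  "L2_subspace M V \<longleftrightarrow> V \<subseteq> L2 M \<and> (\<lambda>_. 0) \<in> V \<and>
     (\<forall>f\<in>V. \<forall>g\<in>V. \<forall>c. (\<lambda>x. c * f x + g x) \<in> V)"

lemma L2_closure_lincomb:
  assumes V: "L2_subspace M V" and f: "f \<in> L2_closure M V" and g: "g \<in> L2_closure M V"
  shows "(\<lambda>x. c * f x + g x) \<in> L2_closure M V"
  unfolding L2_closure_def
proof (intro CollectI conjI allI impI)
  have fL: "f \<in> L2 M" and gL: "g \<in> L2 M"
    using f g by (auto simp: L2_closure_def)
  then show "(\<lambda>x. c * f x + g x) \<in> L2 M"
    by (intro L2_add L2_cmult)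
  fix \<epsilon> :: real assume \<epsilon>: "\<epsilon> > 0"
  \<comment> \<open>Adding 1 keeps the denominator positive when \<open>c\<close> is 0.\<close>
  have "\<epsilon> / (2 * (cmod c + 1)) > 0"
    using \<epsilon> by (intro divide_pos_pos mult_pos_pos add_nonneg_pos) auto
  then obtain f' where f': "f' \<in> V" "L2_norm M (\<lambda>x. f x - f' x) < \<epsilon> / (2 * (cmod c + 1))"
    using f by (auto simp: L2_closure_def)
  obtain g' where g': "g' \<in> V" "L2_norm M (\<lambda>x. g x - g' x) < \<epsilon> / 2"
    using g half_gt_zero[OF \<epsilon>] unfolding L2_closure_def by blast
  have L: "f' \<in> L2 M" "g' \<in> L2 M"
    using V f' g' by (auto simp: L2_subspace_def)
  have "L2_norm M (\<lambda>x. (c * f x + g x) - (c * f' x + g' x)) =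
      L2_norm M (\<lambda>x. c * (f x - f' x) + (g x - g' x))"
    by (simp add: algebra_simps)
  also have "\<dots> \<le> L2_norm M (\<lambda>x. c * (f x - f' x)) + L2_norm M (\<lambda>x. g x - g' x)"
    by (intro L2_norm_triangle L2_cmult L2_diff fL gL L)
  also have "L2_norm M (\<lambda>x. c * (f x - f' x)) \<le> (cmod c + 1) * (\<epsilon> / (2 * (cmod c + 1)))"
    unfolding L2_norm_cmult using f'(2) by (intro mult_mono) auto
  also have "(cmod c + 1) * (\<epsilon> / (2 * (cmod c + 1))) = \<epsilon> / 2"
    using norm_ge_zero[of c] by (simp add: field_simps add_nonneg_eq_0_iff)
  finally have "L2_norm M (\<lambda>x. (c * f x + g x) - (c * f' x + g' x)) < \<epsilon>"
    using g'(2) by linarith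
  moreover have "(\<lambda>x. c * f' x + g' x) \<in> V"
    using V f' g' by (auto simp: L2_subspace_def)
  ultimately show "\<exists>h\<in>V. L2_norm M (\<lambda>x. (c * f x + g x) - h x) < \<epsilon>"
    by (rule bexI[rotated, rotated])
qed

lemma L2_closure_superset: "L2_subspace M V \<Longrightarrow> f \<in> V \<Longrightarrow> f \<in> L2_closure M V"
  unfolding L2_closure_def L2_subspace_def by (auto intro!: bexI[of _ f])

lemma L2_closure_sum:
  assumes V: "L2_subspace M V" and f: "\<And>i. i \<in> I \<Longrightarrow> f i \<in> L2_closure M V"
  shows "(\<lambda>x. \<Sum>i\<in>I. c i * f i x) \<in> L2_closure M V"
proof -
  have "(\<lambda>_. 0) \<in> L2_closure M V"
    using V by (intro L2_closure_superset) (auto simp: L2_subspace_def)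
  then show ?thesis
    using f by (induction I rule: infinite_finite_induct) (auto intro!: L2_closure_lincomb[OF V])
qed

lemma L2_closure_tendsto:
  assumes V: "L2_subspace M V" and s: "\<And>n. s n \<in> L2_closure M V" and f: "f \<in> L2 M"
    and lim: "L2_tendsto M s f"
  shows "f \<in> L2_closure M V"
  unfolding L2_closure_def
proof (intro CollectI conjI allI impI f)
  fix \<epsilon> :: real assume \<epsilon>: "\<epsilon> > 0"
  obtain n where n: "L2_norm M (\<lambda>x. s n x - f x) < \<epsilon> / 2"
    using LIMSEQ_D[OF lim[unfolded L2_tendsto_def] half_gt_zero[OF \<epsilon>]] by auto
  obtain g where g: "g \<in> V" "L2_norm M (\<lambda>x. s n x - g x) < \<epsilon> / 2"
    using s[of n] half_gt_zero[OF \<epsilon>] unfolding L2_closure_def by blast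
  have "L2_norm M (\<lambda>x. f x - g x) \<le> L2_norm M (\<lambda>x. f x - s n x) + L2_norm M (\<lambda>x. s n x - g x)"
    using s[of n] V g(1) by (intro L2_norm_triangle_diff f) (auto simp: L2_closure_def L2_subspace_def)
  then have "L2_norm M (\<lambda>x. f x - g x) < \<epsilon>"
    using n g(2) L2_norm_minus_commute[of M f "s n"] by linarith
  then show "\<exists>g\<in>V. L2_norm M (\<lambda>x. f x - g x) < \<epsilon>"
    using g(1) by blast
qed

text \<open>Simple functions are linear combinations of indicators, and every square integrable
  function is a limit of simple functions of at most twice its modulus. The assumption on indicators
  includes their square integrability, so the measure is finite.\<close>

lemma L2_closure_eq_L2:
  assumes V: "L2_subspace M V" and ind: "\<And>S. S \<in> sets M \<Longrightarrow> indicator S \<in> L2_closure M V"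
  shows "L2_closure M V = L2 M"
proof
  show "L2_closure M V \<subseteq> L2 M" by (auto simp: L2_closure_def)
  show "L2 M \<subseteq> L2_closure M V"
  proof
    fix f assume f: "f \<in> L2 M"
    obtain s where "\<forall>n. simple_function M (s n)"
      and "\<forall>x\<in>space M. (\<lambda>n. s n x) \<longlonglongrightarrow> f x"
      and "\<forall>n. \<forall>x\<in>space M. dist (s n x) 0 \<le> 2 * dist (f x) 0"
      using borel_measurable_implies_sequence_metric[OF L2_measurable[OF f], of 0]
      by (elim exE conjE) (rule that)
    then have s: "\<And>n. simple_function M (s n)"
      and lim: "\<And>x. x \<in> space M \<Longrightarrow> (\<lambda>n. s n x) \<longlonglongrightarrow> f x"
      and bound: "\<And>n x. x \<in> space M \<Longrightarrow> cmod (s n x) \<le> 2 * cmod (f x)"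
      by (simp_all add: dist_norm)
    have meas: "s n \<in> borel_measurable M" for n
      using s by (rule borel_measurable_simple_function)
    have "s n \<in> L2_closure M V" for n
    proof -
      let ?r = "\<lambda>x. \<Sum>y\<in>s n ` space M. y * indicator (s n -` {y} \<inter> space M) x"
      have r: "?r \<in> L2_closure M V"
        by (intro L2_closure_sum[OF V] ind simple_functionD[OF s])
      have eq: "s n x = ?r x" if "x \<in> space M" for x
        by (rule trans[OF simple_function_indicator_representation_banach[OF s that]])
           (simp add: scaleR_conv_of_real mult.commute of_real_indicator)
      have sL: "s n \<in> L2 M"
        using f meas bound by (rule L2_bound)
      \<comment> \<open>The indicator sum agrees with \<open>s n\<close> on \<open>space M\<close>
        only, so the two functions may differ; membership in the closure carries over because norms
        see only \<open>space M\<close>.\<close>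
      show ?thesis
        unfolding L2_closure_def
      proof (intro CollectI conjI allI impI sL)
        fix \<epsilon> :: real assume "\<epsilon> > 0"
        then obtain g where g: "g \<in> V" "L2_norm M (\<lambda>x. ?r x - g x) < \<epsilon>"
          using r unfolding L2_closure_def by blast
        have "L2_norm M (\<lambda>x. s n x - g x) = L2_norm M (\<lambda>x. ?r x - g x)"
          unfolding L2_norm_def
          by (intro arg_cong[where f = sqrt] Bochner_Integration.integral_cong refl)
             (rule arg_cong[OF eq, where f = "\<lambda>z. (cmod (z - g x))\<^sup>2" for x])
        with g show "\<exists>g\<in>V. L2_norm M (\<lambda>x. s n x - g x) < \<epsilon>"
          by (intro bexI[of _ g]) (simp_all only:)
      qed
    qed
    then show "f \<in> L2_closure M V"
      by (rule L2_closure_tendsto[OF V _ f L2_tendsto_dominated[OF meas f lim bound]])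
  qed
qed

text \<open>A Fourier sum is the best approximation from the span of its terms. An approximation
  with \<open>N\<close> terms therefore bounds the error of every Fourier sum with at least
  \<open>N\<close> terms.\<close>

lemma L2_tendsto_fourier:
  assumes u: "\<And>k. u k \<in> L2 M"
    and ortho: "\<And>j k. L2_inner M (u j) (u k) = (if j = k then 1 else 0)"
    and f: "f \<in> L2 M"
    and approx: "\<And>\<epsilon>. \<epsilon> > 0 \<Longrightarrow> \<exists>N a. L2_norm M (\<lambda>x. f x - (\<Sum>k<N. a k * u k x)) < \<epsilon>"
  shows "L2_tendsto M (\<lambda>n x. \<Sum>k<n. L2_inner M (u k) f * u k x) f"
  unfolding L2_tendsto_def
proof (rule LIMSEQ_I)
  fix \<epsilon> :: real assume "\<epsilon> > 0"
  then obtain N a where Na: "L2_norm M (\<lambda>x. f x - (\<Sum>k<N. a k * u k x)) < \<epsilon>"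
    using approx by blast
  have "L2_norm M (\<lambda>x. (\<Sum>k<n. L2_inner M (u k) f * u k x) - f x) < \<epsilon>" if n: "n \<ge> N" for n
  proof -
    \<comment> \<open>Padding with zeros turns the given combination into one of length
      \<open>n\<close>, and \<open>d\<close> is then the Fourier sum minus that combination.\<close>
    define a' where "a' k = (if k < N then a k else 0)" for k
    define S where "S x = (\<Sum>k<n. L2_inner M (u k) f * u k x)" for x
    define d where "d x = (\<Sum>k<n. (L2_inner M (u k) f - a' k) * u k x)" for x
    have S: "S \<in> L2 M" and d: "d \<in> L2 M"
      unfolding S_def d_def by (intro L2_sum L2_cmult u)+
    have a': "(\<Sum>k<n. a' k * u k x) = (\<Sum>k<N. a k * u k x)" for x
      using n by (intro sum.mono_neutral_cong_right) (auto simp: a'_def)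
    have "L2_inner M (\<lambda>x. f x - S x) (u k) = 0" if "k < n" for k
    proof -
      have "L2_inner M S (u k) = (\<Sum>j<n. L2_inner M (\<lambda>x. L2_inner M (u j) f * u j x) (u k))"
        unfolding S_def by (rule L2_inner_sum_left) (auto intro: u L2_cmult)
      also have "\<dots> = (\<Sum>j<n. if j = k then cnj (L2_inner M (u j) f) else 0)"
        by (intro sum.cong) (auto simp: L2_inner_cmult_left ortho)
      also have "\<dots> = cnj (L2_inner M (u k) f)"
        using that by (subst sum.delta) auto
      finally show ?thesis
        by (simp add: L2_inner_diff_left[OF f S u] L2_inner_commute[of M f "u k"])
    qed
    then have "L2_inner M (\<lambda>x. f x - S x) d = 0"
      unfolding d_def by (subst L2_inner_sum_right) (auto intro!: L2_diff f S u L2_cmult simp: L2_inner_cmult_right)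
    \<comment> \<open>Pythagoras: the error f - S is orthogonal to \<open>d\<close>, and their sum
      is the error of the given combination.\<close>
    then have "(L2_norm M (\<lambda>x. f x - S x))\<^sup>2 \<le> (L2_norm M (\<lambda>x. (f x - S x) + d x))\<^sup>2"
      by (subst L2_norm_add_power2) (auto intro!: L2_diff f S d)
    also have "(\<lambda>x. (f x - S x) + d x) = (\<lambda>x. f x - (\<Sum>k<N. a k * u k x))"
      by (auto simp: S_def d_def left_diff_distrib sum_subtractf a')
    finally have "L2_norm M (\<lambda>x. f x - S x) \<le> L2_norm M (\<lambda>x. f x - (\<Sum>k<N. a k * u k x))"
      by (rule power2_le_imp_le) simp
    also note Na
    finally show ?thesis
      unfolding S_def by (subst L2_norm_minus_commute)
  qed
  then show "\<exists>N. \<forall>n\<ge>N. norm (L2_norm M (\<lambda>x. (\<Sum>k<n. L2_inner M (u k) f * u k x) - f x) - 0) < \<epsilon>"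
    by auto
qed

text \<open>Assumption \<open>nonzero\<close> expresses linear independence of \<open>v\<close>: no
  step of the procedure divides by 0. Orthogonality to the earlier vectors holds since each
  subtracted sum is the projection onto their span.\<close>

lemma gram_schmidt_orthonormal:
  fixes v :: "nat \<Rightarrow> 'a \<Rightarrow> complex"
  assumes u: "u = gram_schmidt M v" and v: "\<And>k. v k \<in> L2 M"
    and nonzero: "\<And>k. L2_norm M (\<lambda>x. v k x - (\<Sum>j<k. L2_inner M (u j) (v k) * u j x)) \<noteq> 0"
  shows "u k \<in> L2 M" "L2_inner M (u i) (u k) = (if i = k then 1 else 0)"
proof -
  define w where "w k x = v k x - (\<Sum>j<k. L2_inner M (u j) (v k) * u j x)" for k x
  have u_eq: "u k = (\<lambda>x. inverse (complex_of_real (L2_norm M (w k))) * w k x)" for k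
    unfolding u by (subst gram_schmidt.simps) (simp add: Let_def w_def[abs_def] u divide_inverse mult.commute)
  have uL: "u k \<in> L2 M" for k
  proof (induction k rule: less_induct)
    case (less k)
    then show ?case
      unfolding u_eq[of k] w_def by (intro L2_cmult L2_diff v L2_sum) auto
  qed
  then show "u k \<in> L2 M" .
  have wL: "w k \<in> L2 M" for k
    unfolding w_def by (intro L2_cmult L2_diff v L2_sum uL)
  have diag: "L2_inner M (u k) (u k) = 1" for k
  proof -
    have "L2_norm M (w k) \<noteq> 0"
      using nonzero[of k] by (simp add: w_def[abs_def])
    then show ?thesis
      unfolding u_eq[of k] L2_inner_cmult_left L2_inner_cmult_right L2_inner_self
      by (simp add: power2_eq_square field_simps)
  qed
  \<comment> \<open>The case \<open>i < k\<close> suffices, since conjugation exchanges the two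
    vectors.\<close>
  have less: "i < k \<Longrightarrow> L2_inner M (u i) (u k) = 0" for i k
  proof (induction k arbitrary: i rule: less_induct)
    case (less k)
    have orth: "L2_inner M (u i) (u j) = (if j = i then 1 else 0)" if "j < k" for j
      using less.IH[of j i] less.IH[of i j] less.prems that diag L2_inner_commute[of M "u i" "u j"]
      by (cases i j rule: linorder_cases) auto
    have "L2_inner M (u i) (w k) = L2_inner M (u i) (v k) - (\<Sum>j<k. L2_inner M (u j) (v k) * L2_inner M (u i) (u j))"
      unfolding w_def by (simp add: L2_inner_diff_right L2_inner_sum_right L2_inner_cmult_right uL v L2_sum L2_cmult)
    also have "(\<Sum>j<k. L2_inner M (u j) (v k) * L2_inner M (u i) (u j)) = (\<Sum>j<k. if j = i then L2_inner M (u j) (v k) else 0)"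
      by (intro sum.cong) (auto simp: orth)
    also have "\<dots> = L2_inner M (u i) (v k)"
      using less.prems by simp
    finally show ?case
      unfolding u_eq[of k] L2_inner_cmult_right by simp
  qed
  show "L2_inner M (u i) (u k) = (if i = k then 1 else 0)"
    using diag less[of i k] less[of k i] L2_inner_commute[of M "u i" "u k"]
    by (cases i k rule: linorder_cases) auto
qed

section \<open>Polynomials in the Gram-Schmidt procedure\<close>

abbreviation poly_real :: "complex poly \<Rightarrow> real \<Rightarrow> complex" where
  "poly_real p \<equiv> \<lambda>t. poly p (complex_of_real t)"

text \<open>Assumption \<open>pos\<close> is linear independence of the monomials modulo null sets.
  Both claims come from one induction: the earlier vectors being polynomials of lower degree, the
  remainder is a monic polynomial of degree \<open>k\<close>, so its norm is not 0.\<close>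

lemma gram_schmidt_monomials:
  assumes pos: "\<And>p. p \<noteq> 0 \<Longrightarrow> L2_norm M (poly_real p) \<noteq> 0"
    and u: "u = gram_schmidt M (\<lambda>k t. complex_of_real t ^ k)"
  shows "\<exists>p. degree p = k \<and> p \<noteq> 0 \<and> u k = poly_real p" and
    "L2_norm M (\<lambda>x. complex_of_real x ^ k -
       (\<Sum>j<k. L2_inner M (u j) (\<lambda>t. complex_of_real t ^ k) * u j x)) \<noteq> 0"
proof -
  have *: "(\<exists>p. degree p = k \<and> p \<noteq> 0 \<and> u k = poly_real p) \<and> L2_norm M (\<lambda>x. complex_of_real x ^ k -
       (\<Sum>j<k. L2_inner M (u j) (\<lambda>t. complex_of_real t ^ k) * u j x)) \<noteq> 0" for k
  proof (induction k rule: less_induct)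
    case (less k)
    then have "\<forall>j\<in>{..<k}. \<exists>p. degree p = j \<and> p \<noteq> 0 \<and> u j = poly_real p"
      by blast
    then obtain P where P: "\<forall>j\<in>{..<k}. degree (P j) = j \<and> P j \<noteq> 0 \<and> u j = poly_real (P j)"
      by (rule bchoice[THEN exE])
    define c where "c j = L2_inner M (u j) (\<lambda>t. complex_of_real t ^ k)" for j
    define w where "w = monom 1 k - (\<Sum>j<k. smult (c j) (P j))"
    have "coeff w k = 1"
      using P by (auto simp: w_def coeff_sum coeff_eq_0 intro!: sum.neutral)
    moreover have "degree w \<le> k"
      unfolding w_def using P
      by (intro degree_diff_le degree_sum_le order.trans[OF degree_smult_le]) (auto simp: degree_monom_le)
    ultimately have w: "degree w = k" "w \<noteq> 0"
      by (auto intro!: antisym le_degree)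
    have pw: "(\<lambda>t. complex_of_real t ^ k - (\<Sum>j<k. c j * u j t)) = poly_real w"
      using P by (auto simp: w_def poly_monom poly_sum)
    have "L2_norm M (poly_real w) \<noteq> 0"
      using w by (intro pos)
    moreover have "u k = poly_real (smult (inverse (complex_of_real (L2_norm M (poly_real w)))) w)"
      using gram_schmidt.simps[of M "\<lambda>k t. complex_of_real t ^ k" k]
      unfolding Let_def u[symmetric] c_def[symmetric] pw by (simp add: divide_inverse mult.commute)
    ultimately show ?case
      using w pw unfolding c_def
      by (intro conjI exI[of _ "smult (inverse (complex_of_real (L2_norm M (poly_real w)))) w"]) auto
  qed
  show "\<exists>p. degree p = k \<and> p \<noteq> 0 \<and> u k = poly_real p"
    "L2_norm M (\<lambda>x. complex_of_real x ^ k -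
       (\<Sum>j<k. L2_inner M (u j) (\<lambda>t. complex_of_real t ^ k) * u j x)) \<noteq> 0"
    using * by auto
qed

text \<open>The degrees are triangular: subtracting the right multiple of \<open>P n\<close> removes
  the coefficient of degree \<open>n\<close>.\<close>

lemma poly_graded_span:
  fixes P :: "nat \<Rightarrow> 'a :: field poly"
  assumes P: "\<And>k. degree (P k) = k" "\<And>k. P k \<noteq> 0"
  shows "degree p < n \<Longrightarrow> \<exists>a. p = (\<Sum>k<n. smult (a k) (P k))"
proof (induction n arbitrary: p)
  case (Suc n)
  define c where "c = coeff p n / lead_coeff (P n)"
  define r where "r = p - smult c (P n)"
  have "coeff r n = 0"
    using P(1)[of n] P(2)[of n] leading_coeff_neq_0[of "P n"] by (simp add: r_def c_def)
  moreover have "degree r \<le> n"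
    unfolding r_def using Suc.prems P(1)[of n] by (intro degree_diff_le order.trans[OF degree_smult_le]) auto
  \<comment> \<open>The alternative \<open>r = 0\<close> covers \<open>n = 0\<close>, where no
    degree is below \<open>n\<close>.\<close>
  ultimately have "r = 0 \<or> degree r < n"
    by (metis le_neq_implies_less leading_coeff_0_iff)
  then obtain a where a: "r = (\<Sum>k<n. smult (a k) (P k))"
  proof
    assume "r = 0"
    then show ?thesis using that[of "\<lambda>_. 0"] by simp
  qed (use Suc.IH that in blast)
  have "p = (\<Sum>k<Suc n. smult ((a(n := c)) k) (P k))"
    using a by (simp add: r_def algebra_simps)
  then show ?case by blast
qed simp

subsection \<open>Spectral calculus on a cyclic subspace\<close>

locale spectral_resolution =
  fixes M :: "'a measure" and E :: "real set \<Rightarrow> ('a \<Rightarrow> complex) \<Rightarrow> ('a \<Rightarrow> complex)"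
  assumes resolution: "resolution_of_identity M E"
begin

lemma E_L2: "S \<in> sets borel \<Longrightarrow> f \<in> L2 M \<Longrightarrow> E S f \<in> L2 M"
  using resolution by (auto simp: resolution_of_identity_def orth_projection_def)

lemma E_adjoint: "S \<in> sets borel \<Longrightarrow> f \<in> L2 M \<Longrightarrow> g \<in> L2 M \<Longrightarrow> L2_inner M (E S f) g = L2_inner M f (E S g)"
  using resolution by (auto simp: resolution_of_identity_def orth_projection_def)

lemma E_inner_Int:
  assumes "S \<in> sets borel" "T \<in> sets borel" "f \<in> L2 M" "g \<in> L2 M"
  shows "L2_inner M (E S f) (E T g) = L2_inner M f (E (S \<inter> T) g)"
proof -
  have "AE x in M. E (S \<inter> T) g x = E S (E T g) x"
    using resolution assms by (auto simp: resolution_of_identity_def)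
  then have "L2_inner M f (E (S \<inter> T) g) = L2_inner M f (E S (E T g))"
    using assms by (intro L2_inner_cong_AE E_L2) auto
  then show ?thesis
    using assms by (simp add: E_adjoint E_L2)
qed

lemma E_UNIV_inner: "f \<in> L2 M \<Longrightarrow> g \<in> L2 M \<Longrightarrow> L2_inner M f (E UNIV g) = L2_inner M f g"
  using resolution by (intro L2_inner_cong_AE E_L2) (auto simp: resolution_of_identity_def)

lemma E_commute_inner:
  "S \<in> sets borel \<Longrightarrow> f \<in> L2 M \<Longrightarrow> g \<in> L2 M \<Longrightarrow> L2_inner M g (E S f) = cnj (L2_inner M f (E S g))"
  using L2_inner_commute[of M g "E S f"] by (simp add: E_adjoint)

lemma E_norm_power2:
  assumes "S \<in> sets borel" "f \<in> L2 M"
  shows "complex_of_real ((L2_norm M (E S f))\<^sup>2) = L2_inner M f (E S f)"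
  using E_inner_Int[of S S f f] assms by (simp add: L2_inner_self)

text \<open>For a projection, the squared norm of \<open>E S f\<close> is <f, E S f>, and after
  Cauchy-Schwarz one factor cancels.\<close>

lemma E_norm_le:
  assumes S: "S \<in> sets borel" and f: "f \<in> L2 M"
  shows "L2_norm M (E S f) \<le> L2_norm M f"
proof (cases "L2_norm M (E S f) = 0")
  case False
  have "(L2_norm M (E S f))\<^sup>2 = cmod (L2_inner M f (E S f))"
    by (simp add: norm_power flip: E_norm_power2[OF assms])
  also have "\<dots> \<le> L2_norm M f * L2_norm M (E S f)"
    by (intro L2_Cauchy_Schwarz E_L2 assms)
  finally have "L2_norm M (E S f) * L2_norm M (E S f) \<le> L2_norm M f * L2_norm M (E S f)"
    by (simp add: power2_eq_square)
  then show ?thesis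
    using False L2_norm_nonneg[of M "E S f"] by (simp add: mult_le_cancel_right)
qed simp

text \<open>Each \<open>E S\<close> is a contraction; being linear only up to null sets, it commutes
  with differences only almost everywhere.\<close>

lemma E_tendsto:
  assumes S: "S \<in> sets borel" and s: "\<And>n. s n \<in> L2 M" and f: "f \<in> L2 M" and lim: "L2_tendsto M s f"
  shows "L2_tendsto M (\<lambda>n. E S (s n)) (E S f)"
proof (rule L2_tendstoI_bound)
  show "(\<lambda>n. L2_norm M (\<lambda>x. s n x - f x)) \<longlonglongrightarrow> 0"
    using lim by (simp add: L2_tendsto_def)
  fix n
  have lin: "AE x in M. E S (\<lambda>y. c * f y + g y) x = c * E S f x + E S g x" if "g \<in> L2 M" for c g
    using resolution S f that by (auto simp: resolution_of_identity_def orth_projection_def)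
  \<comment> \<open>The difference is a combination with coefficient -1, the shape of the linearity
    clause in \<open>orth_projection\<close>.\<close>
  have d: "(\<lambda>x. - 1 * f x + s n x) = (\<lambda>x. s n x - f x)"
    by (simp add: fun_eq_iff)
  have "AE x in M. E S (s n) x - E S f x = E S (\<lambda>x. s n x - f x) x"
    using lin[OF s[of n], of "-1"] unfolding d by eventually_elim simp
  then have "L2_norm M (\<lambda>x. E S (s n) x - E S f x) = L2_norm M (E S (\<lambda>x. s n x - f x))"
    by (intro L2_norm_cong_AE L2_measurable L2_diff E_L2 S s f)
  also have "\<dots> \<le> L2_norm M (\<lambda>x. s n x - f x)"
    by (intro E_norm_le S L2_diff s f)
  finally show "L2_norm M (\<lambda>x. E S (s n) x - E S f x) \<le> L2_norm M (\<lambda>x. s n x - f x)" .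
qed

lemma emeasure_dist:
  assumes "f \<in> L2 M" "S \<in> sets borel"
  shows "emeasure (spectral_dist M E f) S = ennreal ((L2_norm M (E S f))\<^sup>2)"
  using emeasure_spectral_dist(1)[OF resolution assms]
  by (simp del: of_real_power flip: E_norm_power2[OF assms(2,1)])

lemma finite_measure_dist: "f \<in> L2 M \<Longrightarrow> finite_measure (spectral_dist M E f)"
  by (rule finite_measureI) (simp add: emeasure_dist)

lemma indicator_L2_dist:
  assumes "f \<in> L2 M" "S \<in> sets borel"
  shows "indicator S \<in> L2 (spectral_dist M E f)"
proof -
  interpret finite_measure "spectral_dist M E f"
    by (rule finite_measure_dist[OF assms(1)])
  have "(\<lambda>_. 1) \<in> L2 (spectral_dist M E f)"
    by (simp add: L2_def)
  then have "(\<lambda>x. indicator S x * 1) \<in> L2 (spectral_dist M E f)"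
    using assms(2) by (intro L2_indicator_mult) auto
  then show ?thesis by simp
qed

lemma measure_dist:
  assumes "f \<in> L2 M" "S \<in> sets borel"
  shows "complex_of_real (measure (spectral_dist M E f) S) = L2_inner M f (E S f)"
  unfolding measure_def by (subst emeasure_dist[OF assms]) (simp add: flip: E_norm_power2[OF assms(2,1)])

end

text \<open>This says that \<open>f = g(A) e\<close> for the operator \<open>A\<close> with spectral resolution \<open>E\<close>.\<close>

definition (in spectral_resolution) represents ::
    "('a \<Rightarrow> complex) \<Rightarrow> (real \<Rightarrow> complex) \<Rightarrow> ('a \<Rightarrow> complex) \<Rightarrow> bool" where
  "represents e g f \<longleftrightarrow> f \<in> L2 M \<and> g \<in> L2 (spectral_dist M E e) \<and>
     (\<forall>S\<in>sets borel.
        L2_inner M e (E S f) = L2_inner (spectral_dist M E e) (indicator S) g \<and>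
        L2_inner M f (E S f) = L2_inner (spectral_dist M E e) g (\<lambda>t. indicator S t * g t))"

section \<open>Functions of the operator applied to a fixed vector\<close>

locale spectral_vector = spectral_resolution +
  fixes e
  assumes e: "e \<in> L2 M"
begin

abbreviation "\<mu> \<equiv> spectral_dist M E e"

lemma ind: "S \<in> sets borel \<Longrightarrow> indicator S \<in> L2 \<mu>"
  by (rule indicator_L2_dist[OF e])

lemma ind_mult: "g \<in> L2 \<mu> \<Longrightarrow> S \<in> sets borel \<Longrightarrow> (\<lambda>t. indicator S t * g t) \<in> L2 \<mu>"
  by (rule L2_indicator_mult) auto

lemma represents_cyclic: "represents e (\<lambda>_. 1) e"
proof -
  have one: "(\<lambda>_. 1) = (indicator UNIV :: real \<Rightarrow> complex)"
    by simp
  have "L2_inner \<mu> (indicator S) (\<lambda>_. 1) = L2_inner M e (E S e)"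
    "L2_inner \<mu> (\<lambda>_. 1) (indicator S) = L2_inner M e (E S e)" if "S \<in> sets borel" for S
  proof -
    interpret finite_measure \<mu> by (rule finite_measure_dist[OF e])
    have "(\<lambda>x. cnj (indicator S x)) = (indicator S :: real \<Rightarrow> complex)"
      by (simp add: fun_eq_iff indicator_def)
    moreover have "(LINT x|\<mu>. indicator S x :: complex) = complex_of_real (measure \<mu> S)"
    proof -
      have "(LINT x|\<mu>. indicator S x :: complex) = (LINT x|\<mu>. complex_of_real (indicator S x))"
        by (intro Bochner_Integration.integral_cong) (auto simp: indicator_def)
      also have "\<dots> = complex_of_real (LINT x|\<mu>. indicator S x)"
        by (rule integral_complex_of_real)
      finally show ?thesis by simp
    qed
    ultimately show "L2_inner \<mu> (indicator S) (\<lambda>_. 1) = L2_inner M e (E S e)"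
      "L2_inner \<mu> (\<lambda>_. 1) (indicator S) = L2_inner M e (E S e)"
      using measure_dist[OF e that] by (simp_all add: L2_inner_def)
  qed
  moreover have "(\<lambda>_. 1) \<in> L2 \<mu>"
    using ind[of UNIV] unfolding one by simp
  ultimately show ?thesis
    using e by (simp add: represents_def)
qed

text \<open>The cross terms with \<open>e\<close> are computable because \<open>represents\<close>
  also records the inner products of \<open>e\<close> with \<open>E S f\<close>. Adding a multiple
  of \<open>e\<close> is the addition in one step of Horner's scheme.\<close>

lemma represents_add:
  assumes "represents e g f"
  shows "represents e (\<lambda>t. a + g t) (\<lambda>x. a * e x + f x)"
proof -
  have f: "f \<in> L2 M" and g: "g \<in> L2 \<mu>"
    using assms by (auto simp: represents_def)
  have one: "(\<lambda>_. 1) \<in> L2 \<mu>"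
    using represents_cyclic by (auto simp: represents_def)
  \<comment> \<open>The constant is kept as \<open>a * 1\<close>, a multiple of the function 1, so
    that linearity of the inner product applies to it.\<close>
  have ag: "(\<lambda>t. a * 1 + g t) \<in> L2 \<mu>"
    by (intro L2_add L2_cmult one g)
  have aef: "(\<lambda>x. a * e x + f x) \<in> L2 M"
    by (intro L2_add L2_cmult e f)
  have 1: "L2_inner M h (E S (\<lambda>x. a * e x + f x)) = a * L2_inner M h (E S e) + L2_inner M h (E S f)"
    if "S \<in> sets borel" "h \<in> L2 M" for S h
    unfolding E_adjoint[OF that aef, symmetric] E_adjoint[OF that e, symmetric] E_adjoint[OF that f, symmetric]
    by (simp add: L2_inner_add_right L2_inner_cmult_right E_L2 that L2_cmult e f)
  have 2: "L2_inner M (\<lambda>x. a * e x + f x) (E S h) = cnj a * L2_inner M e (E S h) + L2_inner M f (E S h)"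
    if "S \<in> sets borel" "h \<in> L2 M" for S h
    by (simp add: L2_inner_add_left L2_inner_cmult_left E_L2 that L2_cmult e f)
  have split: "(\<lambda>t. indicator S t * (a * 1 + g t)) = (\<lambda>t. a * indicator S t + indicator S t * g t)" for S
    by (simp add: fun_eq_iff algebra_simps)
  have "represents e (\<lambda>t. a * 1 + g t) (\<lambda>x. a * e x + f x)"
    unfolding represents_def
  proof (intro conjI ballI ag aef)
    fix S :: "real set" assume S: "S \<in> sets borel"
    have rep_e: "L2_inner M e (E S e) = L2_inner \<mu> (indicator S) (\<lambda>_. 1)"
      "L2_inner M e (E S e) = L2_inner \<mu> (\<lambda>_. 1) (indicator S)"
      using represents_cyclic S by (auto simp: represents_def)
    have rep_f: "L2_inner M e (E S f) = L2_inner \<mu> (indicator S) g"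
        "L2_inner M f (E S f) = L2_inner \<mu> g (\<lambda>t. indicator S t * g t)"
      using assms S by (auto simp: represents_def)
    have fe: "L2_inner M f (E S e) = L2_inner \<mu> g (indicator S)"
      unfolding E_commute_inner[OF S e f] rep_f by (rule L2_inner_commute[symmetric])
    have ef: "L2_inner \<mu> (\<lambda>_. 1) (\<lambda>t. indicator S t * g t) = L2_inner M e (E S f)"
      by (subst rep_f(1), unfold L2_inner_def, intro Bochner_Integration.integral_cong) (auto simp: indicator_def)
    show "L2_inner M e (E S (\<lambda>x. a * e x + f x)) = L2_inner \<mu> (indicator S) (\<lambda>t. a * 1 + g t)"
      by (simp only: 1 S e rep_e(1) rep_f L2_inner_add_right[OF ind[OF S] L2_cmult[OF one] g] L2_inner_cmult_right)
    show "L2_inner M (\<lambda>x. a * e x + f x) (E S (\<lambda>x. a * e x + f x)) =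
        L2_inner \<mu> (\<lambda>t. a * 1 + g t) (\<lambda>t. indicator S t * (a * 1 + g t))"
      unfolding split
      unfolding 2[OF S aef] 1[OF S e] 1[OF S f]
        L2_inner_add_left[OF L2_cmult[OF one] g L2_add[OF L2_cmult[OF ind[OF S]] ind_mult[OF g S]]]
        L2_inner_add_right[OF one L2_cmult[OF ind[OF S]] ind_mult[OF g S]]
        L2_inner_add_right[OF g L2_cmult[OF ind[OF S]] ind_mult[OF g S]]
        L2_inner_cmult_left L2_inner_cmult_right ef fe rep_e(2)[symmetric] rep_f(2)[symmetric]
      by (simp add: algebra_simps)
  qed
  then show ?thesis by simp
qed

text \<open>Both defining equations pass to the limit, since \<open>E S\<close> and multiplication
  by the indicator of \<open>S\<close> are contractions and inner products are continuous.\<close>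

lemma represents_limit:
  assumes rep: "\<And>n. represents e (G n) (F n)"
    and f: "f \<in> L2 M" and limF: "L2_tendsto M F f"
    and g: "g \<in> L2 \<mu>" and limG: "L2_tendsto \<mu> G g"
  shows "represents e g f"
proof -
  have F: "F n \<in> L2 M" and G: "G n \<in> L2 \<mu>" for n
    using rep by (auto simp: represents_def)
  have "L2_inner M e (E S f) = L2_inner \<mu> (indicator S) g \<and>
        L2_inner M f (E S f) = L2_inner \<mu> g (\<lambda>t. indicator S t * g t)" if S: "S \<in> sets borel" for S
  proof
    have "(\<lambda>n. L2_inner M e (E S (F n))) \<longlonglongrightarrow> L2_inner M e (E S f)"
      by (intro L2_tendsto_inner L2_tendsto_const E_tendsto E_L2 S e F f limF)
    moreover have "(\<lambda>n. L2_inner \<mu> (indicator S) (G n)) \<longlonglongrightarrow> L2_inner \<mu> (indicator S) g"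
      by (intro L2_tendsto_inner L2_tendsto_const ind S G g limG)
    ultimately show "L2_inner M e (E S f) = L2_inner \<mu> (indicator S) g"
      using rep S by (auto simp: represents_def intro: LIMSEQ_unique)
    have "(\<lambda>n. L2_inner M (F n) (E S (F n))) \<longlonglongrightarrow> L2_inner M f (E S f)"
      by (intro L2_tendsto_inner E_tendsto E_L2 S F f limF)
    moreover have "(\<lambda>n. L2_inner \<mu> (G n) (\<lambda>t. indicator S t * G n t)) \<longlonglongrightarrow> L2_inner \<mu> g (\<lambda>t. indicator S t * g t)"
      using S by (intro L2_tendsto_inner L2_tendsto_indicator_mult ind_mult G g limG) auto
    ultimately show "L2_inner M f (E S f) = L2_inner \<mu> g (\<lambda>t. indicator S t * g t)"
      using rep S by (auto simp: represents_def intro: LIMSEQ_unique)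
  qed
  then show ?thesis
    using f g by (simp add: represents_def)
qed

text \<open>A simple function is constant on finitely many level sets. Composing \<open>E S\<close>
  with \<open>E\<close> of a level set gives \<open>E\<close> of the intersection, just as
  indicators multiply on the function side.\<close>

lemma represents_simple:
  assumes rep: "represents e g f" and s: "simple_function borel s"
  shows "represents e (\<lambda>t. complex_of_real (s t) * g t)
    (\<lambda>x. \<Sum>c\<in>range s. complex_of_real c * E (s -` {c}) f x)"
proof -
  have f: "f \<in> L2 M" and g: "g \<in> L2 \<mu>"
    using rep by (auto simp: represents_def)
  have fin: "finite (range s)" and lev: "s -` {c} \<in> sets borel" for c
    using simple_functionD(2)[OF s, of "{c}"] simple_functionD(1)[OF s] by auto
  have sg: "complex_of_real (s t) * g t = (\<Sum>c\<in>range s. complex_of_real c * (indicator (s -` {c}) t * g t))" for t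
  proof -
    have "(\<Sum>c\<in>range s. complex_of_real c * (indicator (s -` {c}) t * g t)) =
        (\<Sum>c\<in>range s. if c = s t then complex_of_real c * g t else 0)"
      by (intro sum.cong) (auto simp: indicator_def)
    also have "\<dots> = complex_of_real (s t) * g t"
      using fin by (subst sum.delta) auto
    finally show ?thesis by simp
  qed
  define A where "A x = (\<Sum>c\<in>range s. complex_of_real c * E (s -` {c}) f x)" for x
  define B where "B t = complex_of_real (s t) * g t" for t
  have B_eq: "B = (\<lambda>t. \<Sum>c\<in>range s. complex_of_real c * (indicator (s -` {c}) t * g t))"
    by (simp add: fun_eq_iff B_def sg)
  have A: "A \<in> L2 M"
    unfolding A_def by (intro L2_sum L2_cmult E_L2 lev f)
  have B: "B \<in> L2 \<mu>"
    unfolding B_eq by (intro L2_sum L2_cmult ind_mult lev g)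
  have A_inner: "L2_inner M k (E S A) = (\<Sum>c\<in>range s. complex_of_real c * L2_inner M k (E (S \<inter> s -` {c}) f))"
    if S: "S \<in> sets borel" and k: "k \<in> L2 M" for S k
    unfolding E_adjoint[OF S k A, symmetric] unfolding A_def
    by (simp add: L2_inner_sum_right L2_inner_cmult_right E_L2 L2_cmult lev f S k E_inner_Int)
  have B_inner: "L2_inner \<mu> k B = (\<Sum>c\<in>range s. complex_of_real c * L2_inner \<mu> k (\<lambda>t. indicator (s -` {c}) t * g t))"
    if k: "k \<in> L2 \<mu>" for k
    unfolding B_eq by (simp add: L2_inner_sum_right L2_inner_cmult_right L2_cmult ind_mult lev g k)
  have rep1: "L2_inner M e (E S f) = L2_inner \<mu> (indicator S) g"
    and rep2: "L2_inner M f (E S f) = L2_inner \<mu> g (\<lambda>t. indicator S t * g t)" if "S \<in> sets borel" for S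
    using rep that by (auto simp: represents_def)
  have "L2_inner M e (E S A) = L2_inner \<mu> (indicator S) B \<and>
        L2_inner M A (E S A) = L2_inner \<mu> B (\<lambda>t. indicator S t * B t)" if S: "S \<in> sets borel" for S
  proof
    have shift: "L2_inner \<mu> (indicator (S \<inter> T)) g = L2_inner \<mu> (indicator S) (\<lambda>t. indicator T t * g t)" for T
      unfolding L2_inner_def by (intro Bochner_Integration.integral_cong) (auto simp: indicator_def)
    have ST: "S \<inter> s -` {c} \<in> sets borel" for c
      using S lev by auto
    show "L2_inner M e (E S A) = L2_inner \<mu> (indicator S) B"
      by (simp only: A_inner[OF S e] B_inner[OF ind[OF S]] rep1[OF ST] shift)
    \<comment> \<open>Only one side is expanded here; a second expansion, after conjugation, then
      settles the inner product of \<open>A\<close> with \<open>E S A\<close>.\<close>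
    have fA: "L2_inner M f (E T A) = L2_inner \<mu> (\<lambda>t. indicator T t * g t) B" if T: "T \<in> sets borel" for T
    proof -
      have "L2_inner \<mu> g (\<lambda>t. indicator (T \<inter> U) t * g t) =
          L2_inner \<mu> (\<lambda>t. indicator T t * g t) (\<lambda>t. indicator U t * g t)" for U
        unfolding L2_inner_def by (intro Bochner_Integration.integral_cong) (auto simp: indicator_def)
      moreover have "T \<inter> s -` {c} \<in> sets borel" for c
        using T lev by auto
      ultimately show ?thesis
        by (simp only: A_inner[OF T f] B_inner[OF ind_mult[OF g T]] rep2)
    qed
    have "L2_inner \<mu> B (\<lambda>t. indicator S t * B t) = L2_inner \<mu> (\<lambda>t. indicator S t * B t) B"
      unfolding L2_inner_def by (intro Bochner_Integration.integral_cong) (auto simp: indicator_def)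
    also have "\<dots> = (\<Sum>c\<in>range s. complex_of_real c * L2_inner \<mu> (\<lambda>t. indicator S t * B t) (\<lambda>t. indicator (s -` {c}) t * g t))"
      by (rule B_inner[OF ind_mult[OF B S]])
    also have "\<dots> = (\<Sum>c\<in>range s. complex_of_real c * cnj (L2_inner \<mu> (\<lambda>t. indicator (S \<inter> s -` {c}) t * g t) B))"
    proof (intro sum.cong refl arg_cong2[where f = "(*)"])
      fix c
      show "L2_inner \<mu> (\<lambda>t. indicator S t * B t) (\<lambda>t. indicator (s -` {c}) t * g t) =
          cnj (L2_inner \<mu> (\<lambda>t. indicator (S \<inter> s -` {c}) t * g t) B)"
        unfolding L2_inner_commute[of \<mu> B, symmetric] unfolding L2_inner_def
        by (intro Bochner_Integration.integral_cong) (auto simp: indicator_def)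
    qed
    also have "\<dots> = (\<Sum>c\<in>range s. complex_of_real c * L2_inner M A (E (S \<inter> s -` {c}) f))"
      by (simp only: fA[OF ST, symmetric] E_commute_inner[OF ST f A])
    also have "\<dots> = L2_inner M A (E S A)"
      by (rule A_inner[OF S A, symmetric])
    finally show "L2_inner M A (E S A) = L2_inner \<mu> B (\<lambda>t. indicator S t * B t)" ..
  qed
  then have "represents e B A"
    using A B by (simp add: represents_def)
  then show ?thesis
    by (simp only: A_def[abs_def] B_def[abs_def])
qed

text \<open>Both measures give \<open>S\<close> the value of a squared norm, that of
  \<open>E S f\<close> and that of the indicator of \<open>S\<close> times \<open>g\<close>, and
  these agree by the second equation in \<open>represents\<close>.\<close>

lemma represents_density:
  assumes rep: "represents e g f"
  shows "spectral_dist M E f = density \<mu> (\<lambda>t. ennreal ((cmod (g t))\<^sup>2))"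
proof (rule measure_eqI)
  have f: "f \<in> L2 M" and g: "g \<in> L2 \<mu>"
    using rep by (auto simp: represents_def)
  note [measurable] = L2_measurable[OF g]
  fix S assume "S \<in> sets (spectral_dist M E f)"
  then have S: "S \<in> sets borel" by simp
  have "L2_inner \<mu> g (\<lambda>t. indicator S t * g t) = L2_inner \<mu> (\<lambda>t. indicator S t * g t) (\<lambda>t. indicator S t * g t)"
    unfolding L2_inner_def by (intro Bochner_Integration.integral_cong) (auto simp: indicator_def)
  then have "complex_of_real ((L2_norm M (E S f))\<^sup>2) = complex_of_real ((L2_norm \<mu> (\<lambda>t. indicator S t * g t))\<^sup>2)"
    using rep S by (simp del: of_real_power add: E_norm_power2[OF S f] represents_def L2_inner_self)
  then have "emeasure (spectral_dist M E f) S = ennreal ((L2_norm \<mu> (\<lambda>t. indicator S t * g t))\<^sup>2)"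
    using emeasure_dist[OF f S] by (simp only: of_real_eq_iff)
  also have "\<dots> = (\<integral>\<^sup>+t. ennreal ((cmod (indicator S t * g t))\<^sup>2) \<partial>\<mu>)"
    by (rule ennreal_L2_norm_power2[OF ind_mult[OF g S]])
  also have "\<dots> = (\<integral>\<^sup>+t. ennreal ((cmod (g t))\<^sup>2) * indicator S t \<partial>\<mu>)"
    by (intro nn_integral_cong) (auto simp: indicator_def)
  also have "\<dots> = emeasure (density \<mu> (\<lambda>t. ennreal ((cmod (g t))\<^sup>2))) S"
    using S by (subst emeasure_density) auto
  finally show "emeasure (spectral_dist M E f) S = emeasure (density \<mu> (\<lambda>t. ennreal ((cmod (g t))\<^sup>2))) S" .
qed simp

text \<open>This is the step from \<open>f\<close> to its image under the operator. The simple
  functions \<open>s n\<close> converge to t in the mean square of the spectral distribution of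
  \<open>f\<close>. That distribution has density |g|^2 with respect to \<open>\<mu>\<close>, so
  \<open>s n\<close> times \<open>g\<close> converges to t g in L2 of \<open>\<mu>\<close>, while
  the vectors converge to \<open>h\<close>.\<close>

lemma represents_spectral_integral:
  assumes rep: "represents e g f" and int: "(f, h) \<in> spectral_integral M E"
  shows "represents e (\<lambda>t. complex_of_real t * g t) h"
proof -
  have g: "g \<in> L2 \<mu>"
    using rep by (auto simp: represents_def)
  note [measurable] = L2_measurable[OF g] and [measurable_cong] = sets_spectral_dist
  from int obtain s where h: "h \<in> L2 M" and sq: "integrable (spectral_dist M E f) (\<lambda>t. t\<^sup>2)"
    and s: "\<And>n. simple_function borel (s n)"
    and lim: "(\<lambda>n. \<integral>\<^sup>+t. ennreal ((s n t - t)\<^sup>2) \<partial>spectral_dist M E f) \<longlonglongrightarrow> 0"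
    and limh: "L2_tendsto M (\<lambda>n x. \<Sum>c\<in>range (s n). complex_of_real c * E (s n -` {c}) f x) h"
    by (auto simp: spectral_integral_def)
  have [measurable]: "s n \<in> borel_measurable borel" for n
    using s by (rule borel_measurable_simple_function)
  \<comment> \<open>By the density formula, the domain condition on \<open>f\<close> is exactly
    square integrability of t g.\<close>
  have "integrable \<mu> (\<lambda>t. (cmod (g t))\<^sup>2 *\<^sub>R t\<^sup>2)"
    using sq unfolding represents_density[OF rep]
    by (subst (asm) integrable_density) (auto intro: borel_measurable_power)
  then have tg: "(\<lambda>t. complex_of_real t * g t) \<in> L2 \<mu>"
    by (auto simp: L2_def norm_mult power_mult_distrib mult.commute)
  have sg: "(\<lambda>t. complex_of_real (s n t) * g t) \<in> L2 \<mu>" for n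
    using represents_simple[OF rep s[of n]] by (auto simp: represents_def)
  have "(\<integral>\<^sup>+t. ennreal ((s n t - t)\<^sup>2) \<partial>spectral_dist M E f) =
      ennreal ((L2_norm \<mu> (\<lambda>t. complex_of_real (s n t) * g t - complex_of_real t * g t))\<^sup>2)" for n
  proof -
    have "(\<integral>\<^sup>+t. ennreal ((s n t - t)\<^sup>2) \<partial>spectral_dist M E f) =
        (\<integral>\<^sup>+t. ennreal ((cmod (g t))\<^sup>2) * ennreal ((s n t - t)\<^sup>2) \<partial>\<mu>)"
      unfolding represents_density[OF rep] by (subst nn_integral_density) auto
    also have "\<dots> = (\<integral>\<^sup>+t. ennreal ((cmod (complex_of_real (s n t) * g t - complex_of_real t * g t))\<^sup>2) \<partial>\<mu>)"
    proof (intro nn_integral_cong)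
      fix t
      have "cmod (complex_of_real (s n t) * g t - complex_of_real t * g t) = \<bar>s n t - t\<bar> * cmod (g t)"
        by (simp flip: left_diff_distrib of_real_diff add: norm_mult)
      then show "ennreal ((cmod (g t))\<^sup>2) * ennreal ((s n t - t)\<^sup>2) =
          ennreal ((cmod (complex_of_real (s n t) * g t - complex_of_real t * g t))\<^sup>2)"
        by (simp add: power_mult_distrib mult.commute flip: ennreal_mult)
    qed
    finally show ?thesis
      by (simp add: ennreal_L2_norm_power2[OF L2_diff[OF sg tg]])
  qed
  with lim have "(\<lambda>n. ennreal ((L2_norm \<mu> (\<lambda>t. complex_of_real (s n t) * g t - complex_of_real t * g t))\<^sup>2)) \<longlonglongrightarrow> ennreal 0"
    by simp
  then have "(\<lambda>n. (L2_norm \<mu> (\<lambda>t. complex_of_real (s n t) * g t - complex_of_real t * g t))\<^sup>2) \<longlonglongrightarrow> 0"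
    by (subst (asm) tendsto_ennreal_iff) auto
  from tendsto_real_sqrt[OF this]
  have "L2_tendsto \<mu> (\<lambda>n t. complex_of_real (s n t) * g t) (\<lambda>t. complex_of_real t * g t)"
    by (simp add: L2_tendsto_def)
  from represents_limit[OF represents_simple[OF rep s] h limh tg this] show ?thesis .
qed

text \<open>The second equation in \<open>represents\<close> at the whole line, where
  \<open>E\<close> is the identity.\<close>

lemma represents_norm:
  assumes "represents e g f"
  shows "L2_norm \<mu> g = L2_norm M f"
proof -
  have f: "f \<in> L2 M"
    using assms by (auto simp: represents_def)
  have "L2_inner M f (E UNIV f) = L2_inner \<mu> g (\<lambda>t. indicator UNIV t * g t)"
    using assms by (auto simp: represents_def simp del: indicator_UNIV)
  then have "(L2_norm \<mu> g)\<^sup>2 = (L2_norm M f)\<^sup>2"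
    by (simp add: E_UNIV_inner f L2_inner_self del: of_real_power)
  then show ?thesis by simp
qed

text \<open>In the expansions of the two squared distances the squares match by
  \<open>represents_cyclic\<close> and \<open>represents_norm\<close>, the mixed term by the first
  equation in \<open>represents\<close>. This turns approximation of an indicator into approximation
  of \<open>E S e\<close>.\<close>

lemma represents_distance:
  assumes rep: "represents e g f" and S: "S \<in> sets borel"
  shows "L2_norm \<mu> (\<lambda>t. indicator S t - g t) = L2_norm M (\<lambda>x. E S e x - f x)"
proof -
  have f: "f \<in> L2 M" and g: "g \<in> L2 \<mu>"
    using rep by (auto simp: represents_def)
  have "L2_inner \<mu> (indicator S) (indicator S) = L2_inner \<mu> (indicator S) (\<lambda>_. 1)"
    unfolding L2_inner_def by (intro Bochner_Integration.integral_cong) (auto simp: indicator_def)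
  also have "\<dots> = L2_inner M e (E S e)"
    using represents_cyclic S by (simp add: represents_def)
  finally have "(L2_norm \<mu> (indicator S))\<^sup>2 = (L2_norm M (E S e))\<^sup>2"
    unfolding L2_inner_self E_norm_power2[OF S e, symmetric] of_real_eq_iff .
  moreover have "L2_norm \<mu> g = L2_norm M f"
    by (rule represents_norm[OF rep])
  moreover have "L2_inner \<mu> (indicator S) g = L2_inner M (E S e) f"
    using rep S e f by (simp add: represents_def E_adjoint)
  ultimately have "(L2_norm \<mu> (\<lambda>t. indicator S t - g t))\<^sup>2 = (L2_norm M (\<lambda>x. E S e x - f x))\<^sup>2"
    by (simp add: L2_norm_diff_power2 ind S g E_L2 e f)
  then show ?thesis
    by simp
qed

end

subsection \<open>Density of polynomials in the spectral measure of a Jacobi matrix\<close>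

lemma finite_support_nat_iff: "finite {k :: nat. \<phi> k \<noteq> (0 :: complex)} \<longleftrightarrow> (\<exists>N. \<forall>k\<ge>N. \<phi> k = 0)"
  unfolding finite_nat_set_iff_bounded by (auto simp: not_less[symmetric])

lemma finite_support_L2: "finite {k. \<phi> k \<noteq> 0} \<Longrightarrow> \<phi> \<in> L2 cnt"
  unfolding L2_cnt_iff by (rule summable_finite) auto

lemma op_closure_superset: "(f, g) \<in> A \<Longrightarrow> f \<in> L2 M \<Longrightarrow> g \<in> L2 M \<Longrightarrow> (f, g) \<in> op_closure M A"
  unfolding op_closure_def
  by (intro CollectI case_prodI conjI exI[of _ "\<lambda>_. f"] exI[of _ "\<lambda>_. g"] allI L2_tendsto_const)

lemma jacobi_apply_lincomb:
  "jacobi_apply q b (\<lambda>j. c * \<phi> j + \<psi> j) = (\<lambda>j. c * jacobi_apply q b \<phi> j + jacobi_apply q b \<psi> j)"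
  by (simp add: jacobi_apply_def fun_eq_iff algebra_simps)

lemma jacobi_apply_zero: "jacobi_apply q b (\<lambda>_. 0) = (\<lambda>_. 0)"
  by (simp add: jacobi_apply_def fun_eq_iff)

lemma finite_support_jacobi_apply:
  assumes "finite {k. \<phi> k \<noteq> 0}"
  shows "finite {k. jacobi_apply q b \<phi> k \<noteq> 0}"
proof -
  obtain N where "\<forall>k\<ge>N. \<phi> k = 0"
    using assms by (auto simp: finite_support_nat_iff)
  then have "\<forall>k\<ge>Suc N. jacobi_apply q b \<phi> k = 0"
    by (auto simp: jacobi_apply_def)
  then show ?thesis
    unfolding finite_support_nat_iff by blast
qed

text \<open>Since \<open>Jt \<subseteq> J\<^sup>*\<close> and \<open>Jt\<close> is selfadjoint, \<open>Jt = Jt\<^sup>* \<supseteq> J\<^sup>*\<^sup>* \<supseteq> J\<close>.\<close>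

lemma canonical_sa_extension_finite_support:
  assumes ext: "canonical_sa_extension cnt (jacobi_operator q b) Jt" and \<phi>: "finite {k. \<phi> k \<noteq> 0}"
  shows "(\<phi>, jacobi_apply q b \<phi>) \<in> Jt"
proof -
  have L: "\<phi> \<in> L2 cnt" "jacobi_apply q b \<phi> \<in> L2 cnt"
    using \<phi> by (auto intro: finite_support_L2 finite_support_jacobi_apply)
  then have J: "(\<phi>, jacobi_apply q b \<phi>) \<in> jacobi_operator q b"
    unfolding jacobi_operator_def using \<phi> by (intro op_closure_superset) auto
  have "(\<phi>, jacobi_apply q b \<phi>) \<in> op_adjoint cnt Jt"
    unfolding op_adjoint_def
  proof (intro CollectI case_prodI conjI L ballI, clarify)
    fix u v assume "(u, v) \<in> Jt"
    then have "(u, v) \<in> op_adjoint cnt (jacobi_operator q b)"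
      using ext by (auto simp: canonical_sa_extension_def)
    then have "L2_inner cnt u (jacobi_apply q b \<phi>) = L2_inner cnt v \<phi>"
      using J by (auto simp: op_adjoint_def)
    then show "L2_inner cnt \<phi> v = L2_inner cnt (jacobi_apply q b \<phi>) u"
      using L2_inner_commute[of cnt \<phi> v] L2_inner_commute[of cnt "jacobi_apply q b \<phi>" u] by simp
  qed
  then show ?thesis
    using ext by (simp add: canonical_sa_extension_def selfadjoint_def)
qed

text \<open>The vector \<open>p(J) \<delta>\<^sub>0\<close>, evaluated by Horner's scheme.\<close>

definition jacobi_poly :: "(nat \<Rightarrow> real) \<Rightarrow> (nat \<Rightarrow> real) \<Rightarrow> complex poly \<Rightarrow> nat \<Rightarrow> complex" where
  "jacobi_poly q b p = fold_coeffs (\<lambda>a \<phi> j. a * delta 0 j + jacobi_apply q b \<phi> j) p (\<lambda>_. 0)"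

lemma jacobi_poly_0 [simp]: "jacobi_poly q b 0 = (\<lambda>_. 0)"
  by (simp add: jacobi_poly_def)

lemma jacobi_poly_pCons:
  "jacobi_poly q b (pCons a p) = (\<lambda>j. a * delta 0 j + jacobi_apply q b (jacobi_poly q b p) j)"
  \<comment> \<open>\<open>fold_coeffs\<close> runs over no coefficient at all when \<open>a\<close>
    and \<open>p\<close> are both 0; then both sides are the zero sequence.\<close>
  by (cases "p = 0"; cases "a = 0")
     (simp_all add: jacobi_poly_def fold_coeffs_pCons_eq fold_coeffs_pCons_coeff_not_0_eq jacobi_apply_zero fun_eq_iff)

lemma jacobi_poly_lincomb:
  "jacobi_poly q b (smult c p + r) = (\<lambda>j. c * jacobi_poly q b p j + jacobi_poly q b r j)"
proof (induction p r rule: poly_induct2)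
  case (pCons a p a' r)
  have "smult c (pCons a p) + pCons a' r = pCons (c * a + a') (smult c p + r)"
    by simp
  then show ?case
    by (simp only: jacobi_poly_pCons pCons.IH jacobi_apply_lincomb) (simp add: fun_eq_iff algebra_simps)
qed simp

text \<open>One application of the matrix enlarges the support by at most one index, and Horner's
  scheme applies it once per degree.\<close>

lemma jacobi_poly_above_degree: "k > degree p \<Longrightarrow> jacobi_poly q b p k = 0"
proof (induction p arbitrary: k)
  case (pCons a p)
  then show ?case
    by (cases "p = 0") (auto simp: jacobi_poly_pCons jacobi_apply_zero jacobi_apply_def delta_def)
qed simp

text \<open>At the top degree only the subdiagonal term survives, so each Horner step multiplies the
  entry there by an entry of \<open>b\<close>; the result is the leading coefficient times a product
  of positive numbers.\<close>

lemma jacobi_poly_degree_nonzero: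
  assumes b: "\<And>k. b k > 0"
  shows "p \<noteq> 0 \<Longrightarrow> jacobi_poly q b p (degree p) \<noteq> 0"
proof (induction p)
  case (pCons a p)
  show ?case
  proof (cases "p = 0")
    case True
    then show ?thesis
      using pCons.hyps by (auto simp: jacobi_poly_pCons jacobi_apply_zero delta_def)
  next
    case False
    then show ?thesis
      using pCons.IH b[of "degree p"]
      by (auto simp: jacobi_poly_pCons jacobi_apply_def delta_def jacobi_poly_above_degree)
  qed
qed simp

lemma finite_support_jacobi_poly: "finite {k. jacobi_poly q b p k \<noteq> 0}"
  unfolding finite_support_nat_iff using jacobi_poly_above_degree[of p]
  by (intro exI[of _ "Suc (degree p)"]) auto

text \<open>Elimination from the top: \<open>jacobi_poly q b (monom 1 N)\<close> ends at index
  \<open>N\<close> with a nonzero entry, so a multiple of it removes the entry of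
  \<open>\<phi>\<close> at \<open>N\<close>.\<close>

lemma finite_support_eq_jacobi_poly:
  assumes b: "\<And>k. b k > 0"
  shows "\<forall>k\<ge>N. \<phi> k = 0 \<Longrightarrow> \<exists>p. \<phi> = jacobi_poly q b p"
proof (induction N arbitrary: \<phi>)
  case 0
  then show ?case by (intro exI[of _ 0]) auto
next
  case (Suc N)
  define m :: "complex poly" where "m = monom 1 N"
  have m: "degree m = N" "m \<noteq> 0"
    by (auto simp: m_def degree_monom_eq)
  define c where "c = - \<phi> N / jacobi_poly q b m N"
  have nz: "jacobi_poly q b m N \<noteq> 0"
    using jacobi_poly_degree_nonzero[where b = b and q = q, OF b m(2)] m by simp
  have "\<forall>k\<ge>N. c * jacobi_poly q b m k + \<phi> k = 0"
  proof (intro allI impI)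
    fix k assume "N \<le> k"
    then consider "k = N" | "k > N" "k \<ge> Suc N" by linarith
    then show "c * jacobi_poly q b m k + \<phi> k = 0"
      using Suc.prems nz m(1) by cases (auto simp: c_def jacobi_poly_above_degree)
  qed
  from Suc.IH[OF this] obtain p where p: "(\<lambda>k. c * jacobi_poly q b m k + \<phi> k) = jacobi_poly q b p"
    by blast
  have "\<phi> = jacobi_poly q b (smult (- c) m + p)"
    unfolding jacobi_poly_lincomb p[symmetric] by simp
  then show ?case by blast
qed

lemma (in spectral_vector) represents_zero: "represents e (\<lambda>_. 0) (\<lambda>_. 0)"
  unfolding represents_def by (auto simp: e E_adjoint[symmetric])

lemma delta_L2: "delta k \<in> L2 cnt"
  by (rule finite_support_L2) (auto simp: delta_def)

text \<open>Induction along Horner's scheme. The vectors have finite support, where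
  \<open>Jt\<close> acts as the matrix, so multiplication by t on the function side corresponds to
  \<open>jacobi_apply\<close> on the vector side.\<close>

lemma jacobi_represents:
  assumes ext: "canonical_sa_extension cnt (jacobi_operator q b) Jt" and spec: "is_spectral_measure cnt Jt E"
  shows "spectral_resolution.represents cnt E (delta 0) (poly_real p) (jacobi_poly q b p)"
proof -
  interpret spectral_vector cnt E "delta 0"
    using spec by unfold_locales (auto simp: is_spectral_measure_def delta_L2)
  show ?thesis
  proof (induction p)
    case 0
    then show ?case using represents_zero by simp
  next
    case (pCons a p)
    have "(jacobi_poly q b p, jacobi_apply q b (jacobi_poly q b p)) \<in> Jt"
      by (rule canonical_sa_extension_finite_support[OF ext finite_support_jacobi_poly])
    then have "(jacobi_poly q b p, jacobi_apply q b (jacobi_poly q b p)) \<in> spectral_integral cnt E"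
      using spec by (simp add: is_spectral_measure_def)
    from represents_add[OF represents_spectral_integral[OF pCons.IH this], of a] show ?case
      by (simp add: jacobi_poly_pCons)
  qed
qed

text \<open>These are the properties that the rest of the proof takes from the spectral measure.
  Condition \<open>poly_norm\<close> says that \<open>\<mu>\<close> is not carried by finitely many
  points.\<close>

locale dense_polynomials = finite_measure \<mu> for \<mu> :: "real measure" +
  assumes sets_borel: "sets \<mu> = sets borel"
    and poly_L2: "\<And>p. poly_real p \<in> L2 \<mu>"
    and poly_norm: "\<And>p. p \<noteq> 0 \<Longrightarrow> L2_norm \<mu> (poly_real p) \<noteq> 0"
    and poly_dense: "L2_closure \<mu> (range poly_real) = L2 \<mu>"

lemma poly_subspace:
  assumes "\<And>p. poly_real p \<in> L2 \<mu>"
  shows "L2_subspace \<mu> (range poly_real)"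
  unfolding L2_subspace_def
proof (intro conjI ballI allI)
  show "(\<lambda>_. 0) \<in> range poly_real"
    by (rule range_eqI[of _ _ 0]) simp
  fix g h :: "real \<Rightarrow> complex" and c assume "g \<in> range poly_real" "h \<in> range poly_real"
  then obtain p r where "g = poly_real p" "h = poly_real r" by auto
  then show "(\<lambda>x. c * g x + h x) \<in> range poly_real"
    by (intro range_eqI[of _ _ "smult c p + r"]) simp
qed (use assms in auto)

lemma jacobi_dense_polynomials:
  assumes b: "\<And>k. b k > 0"
    and ext: "canonical_sa_extension cnt (jacobi_operator q b) Jt" and spec: "is_spectral_measure cnt Jt E"
  shows "dense_polynomials (spectral_dist cnt E (delta 0))"
proof -
  interpret spectral_vector cnt E "delta 0"
    using spec by unfold_locales (auto simp: is_spectral_measure_def delta_L2)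
  have rep: "represents (delta 0) (poly_real p) (jacobi_poly q b p)" for p
    by (rule jacobi_represents[OF ext spec])
  interpret finite_measure \<mu>
    by (rule finite_measure_dist[OF e])
  have L2: "poly_real p \<in> L2 \<mu>" for p
    using rep[of p] by (simp add: represents_def)
  show ?thesis
  proof
    show "sets \<mu> = sets borel" "\<And>p. poly_real p \<in> L2 \<mu>"
      by (simp_all add: L2)
    \<comment> \<open>The norm is that of \<open>jacobi_poly q b p\<close>, whose entry at
      \<open>degree p\<close> is not 0.\<close>
    show "L2_norm \<mu> (poly_real p) \<noteq> 0" if "p \<noteq> 0" for p
      using jacobi_poly_degree_nonzero[where b = b and q = q, OF b that]
        L2_norm_eq_0_iff[OF finite_support_L2[OF finite_support_jacobi_poly[of q b p]]]
      by (auto simp: represents_norm[OF rep] AE_count_space)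
    show "L2_closure \<mu> (range poly_real) = L2 \<mu>"
    proof (rule L2_closure_eq_L2[OF poly_subspace[OF L2]])
      fix S assume "S \<in> sets \<mu>"
      then have S: "S \<in> sets borel" by simp
      define \<psi> where "\<psi> = E S (delta 0)"
      have \<psi>: "\<psi> \<in> L2 cnt"
        unfolding \<psi>_def by (rule E_L2[OF S e])
      \<comment> \<open>Truncations of \<open>\<psi>\<close> have finite support, so each of them is
        some p(J) applied to \<open>delta 0\<close>.\<close>
      have "L2_tendsto cnt (\<lambda>n k. if k < n then \<psi> k else 0) \<psi>"
      proof (rule L2_tendsto_dominated[where C = 1])
        show "(\<lambda>n. if k < n then \<psi> k else 0) \<longlonglongrightarrow> \<psi> k" for k
          by (rule tendsto_eventually) (auto simp: eventually_at_top_dense)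
      qed (auto simp: \<psi>)
      then have lim: "(\<lambda>n. L2_norm cnt (\<lambda>k. (if k < n then \<psi> k else 0) - \<psi> k)) \<longlonglongrightarrow> 0"
        by (simp add: L2_tendsto_def)
      show "indicator S \<in> L2_closure \<mu> (range poly_real)"
        unfolding L2_closure_def
      proof (intro CollectI conjI allI impI ind S)
        fix \<epsilon> :: real assume "\<epsilon> > 0"
        from LIMSEQ_D[OF lim this] obtain n where n: "L2_norm cnt (\<lambda>k. (if k < n then \<psi> k else 0) - \<psi> k) < \<epsilon>"
          by auto
        obtain p where p: "(\<lambda>k. if k < n then \<psi> k else 0) = jacobi_poly q b p"
          using finite_support_eq_jacobi_poly[where b = b and q = q and N = n, OF b, of "\<lambda>k. if k < n then \<psi> k else 0"] by auto
        have "L2_norm \<mu> (\<lambda>t. indicator S t - poly_real p t) = L2_norm cnt (\<lambda>k. \<psi> k - (if k < n then \<psi> k else 0))"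
          unfolding represents_distance[OF rep S] \<psi>_def[symmetric] p[symmetric] ..
        then show "\<exists>g\<in>range poly_real. L2_norm \<mu> (\<lambda>t. indicator S t - g t) < \<epsilon>"
          using n L2_norm_minus_commute[of cnt \<psi> "\<lambda>k. if k < n then \<psi> k else 0"]
          by (intro bexI[of _ "poly_real p"]) auto
      qed
    qed
  qed
qed

subsection \<open>The multiplication operator\<close>

lemma L2_tendsto_AE_unique:
  assumes s: "\<And>n. s n \<in> L2 M" and f: "f \<in> L2 M" "L2_tendsto M s f" and g: "g \<in> L2 M" "L2_tendsto M s g"
  shows "AE x in M. f x = g x"
proof -
  have lim: "(\<lambda>n. L2_norm M (\<lambda>x. s n x - f x) + L2_norm M (\<lambda>x. s n x - g x)) \<longlonglongrightarrow> 0"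
    using tendsto_add[OF f(2)[unfolded L2_tendsto_def] g(2)[unfolded L2_tendsto_def]] by simp
  have "L2_norm M (\<lambda>x. f x - g x) \<le> L2_norm M (\<lambda>x. s n x - f x) + L2_norm M (\<lambda>x. s n x - g x)" for n
    using L2_norm_triangle_diff[OF f(1) s[of n] g(1)] L2_norm_minus_commute[of M f "s n"] by linarith
  then have "L2_norm M (\<lambda>x. f x - g x) \<le> 0"
    by (intro LIMSEQ_le_const[OF lim]) auto
  then have "L2_norm M (\<lambda>x. f x - g x) = 0"
    by (simp add: antisym)
  then show ?thesis
    using L2_norm_eq_0_iff[OF L2_diff[OF f(1) g(1)]] by simp
qed

lemma L2_bounded_mult:
  assumes "f \<in> L2 M" "m \<in> borel_measurable M" "\<And>x. cmod (m x) \<le> K"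
  shows "(\<lambda>x. m x * f x) \<in> L2 M" "L2_norm M (\<lambda>x. m x * f x) \<le> K * L2_norm M f"
proof -
  have bd: "cmod (m x * f x) \<le> K * cmod (f x)" for x
    using assms(3) by (simp add: norm_mult mult_right_mono)
  have meas: "(\<lambda>x. m x * f x) \<in> borel_measurable M"
    using assms(1,2) by (intro borel_measurable_times) (auto dest: L2_measurable)
  show "(\<lambda>x. m x * f x) \<in> L2 M"
    using assms(1) meas bd by (rule L2_bound)
  have K: "0 \<le> K"
    using assms(3) norm_ge_zero order.trans by blast
  have "L2_norm M (\<lambda>x. m x * f x) \<le> L2_norm M (\<lambda>x. complex_of_real K * f x)"
    using assms(1) meas bd K by (intro L2_norm_mono L2_cmult) (auto simp: norm_mult)
  then show "L2_norm M (\<lambda>x. m x * f x) \<le> K * L2_norm M f"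
    using K by (simp add: L2_norm_cmult)
qed

lemma L2_tendsto_bounded_mult:
  assumes s: "\<And>n. s n \<in> L2 M" and f: "f \<in> L2 M" and lim: "L2_tendsto M s f"
    and m: "m \<in> borel_measurable M" "\<And>x. cmod (m x) \<le> K"
  shows "L2_tendsto M (\<lambda>n x. m x * s n x) (\<lambda>x. m x * f x)"
proof (rule L2_tendstoI_bound)
  show "L2_norm M (\<lambda>x. m x * s n x - m x * f x) \<le> K * L2_norm M (\<lambda>x. s n x - f x)" for n
    using L2_bounded_mult(2)[OF L2_diff[OF s[of n] f] m] by (simp add: right_diff_distrib)
  show "(\<lambda>n. K * L2_norm M (\<lambda>x. s n x - f x)) \<longlonglongrightarrow> 0"
    using tendsto_mult_right_zero[OF lim[unfolded L2_tendsto_def]] .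
qed

lemma L2_tendsto_cong_AE:
  assumes "\<And>n. s n \<in> L2 M" "\<And>n. s' n \<in> L2 M" "f \<in> L2 M" "f' \<in> L2 M"
    and "\<And>n. AE x in M. s n x = s' n x" "AE x in M. f x = f' x" and lim: "L2_tendsto M s f"
  shows "L2_tendsto M s' f'"
proof -
  have "L2_norm M (\<lambda>x. s n x - f x) = L2_norm M (\<lambda>x. s' n x - f' x)" for n
  proof (rule L2_norm_cong_AE)
    show "AE x in M. s n x - f x = s' n x - f' x"
      using assms(5)[of n] assms(6) by eventually_elim simp
  qed (intro L2_measurable L2_diff assms)+
  then show ?thesis
    using lim by (simp add: L2_tendsto_def)
qed

lemma linear_op_sum:
  assumes A: "linear_op M A" and "\<And>i. i \<in> I \<Longrightarrow> (f i, g i) \<in> A"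
  shows "(\<lambda>x. \<Sum>i\<in>I. c i * f i x, \<lambda>x. \<Sum>i\<in>I. c i * g i x) \<in> A"
  using assms(2)
proof (induction I rule: infinite_finite_induct)
  case (insert i I)
  then have "(f i, g i) \<in> A" "(\<lambda>x. \<Sum>i\<in>I. c i * f i x, \<lambda>x. \<Sum>i\<in>I. c i * g i x) \<in> A"
    by auto
  then have "(\<lambda>x. c i * f i x + (\<Sum>i\<in>I. c i * f i x), \<lambda>x. c i * g i x + (\<Sum>i\<in>I. c i * g i x)) \<in> A"
    using A unfolding linear_op_def by blast
  then show ?case
    using insert.hyps by simp
qed (use A in \<open>auto simp: linear_op_def\<close>)

section \<open>Bounds on t - i and closedness of multiplication\<close>

lemma cmod_resolvent: "cmod (complex_of_real t - \<i>) = sqrt (1 + t\<^sup>2)"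
  by (simp add: cmod_def add.commute)

lemma cmod_resolvent_ge: "1 \<le> cmod (complex_of_real t - \<i>)" "\<bar>t\<bar> \<le> cmod (complex_of_real t - \<i>)"
  unfolding cmod_resolvent by (auto intro: real_le_rsqrt)

lemma resolvent_nonzero [simp]: "complex_of_real t \<noteq> \<i>"
  using cmod_resolvent_ge(1)[of t] by auto

text \<open>The integrability condition in \<open>mult_op\<close> follows from square integrability
  of \<open>g\<close>, which is t f almost everywhere.\<close>

lemma mem_mult_op_iff:
  assumes sets: "sets \<mu> = sets borel"
  shows "(f, g) \<in> mult_op \<mu> \<longleftrightarrow> f \<in> L2 \<mu> \<and> g \<in> L2 \<mu> \<and> (AE t in \<mu>. g t = complex_of_real t * f t)"
proof -
  note [measurable_cong] = sets
  have "integrable \<mu> (\<lambda>t. t\<^sup>2 * (cmod (f t))\<^sup>2)"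
    if f: "f \<in> L2 \<mu>" and g: "g \<in> L2 \<mu>" and ae: "AE t in \<mu>. g t = complex_of_real t * f t"
  proof (rule integrable_cong_AE_imp[OF L2_integrable[OF g]])
    note [measurable] = L2_measurable[OF f]
    show "(\<lambda>t. t\<^sup>2 * (cmod (f t))\<^sup>2) \<in> borel_measurable \<mu>"
      by measurable
    show "AE t in \<mu>. (cmod (g t))\<^sup>2 = t\<^sup>2 * (cmod (f t))\<^sup>2"
      using ae by eventually_elim (simp add: norm_mult power_mult_distrib)
  qed
  then show ?thesis
    by (auto simp: mult_op_def)
qed

lemma closed_mult_op:
  assumes sets: "sets \<mu> = sets borel"
  shows "closed_op \<mu> (mult_op \<mu>)"
  unfolding closed_op_def
proof
  note mem = mem_mult_op_iff[OF sets]
  note [measurable_cong] = sets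
  show "linear_op \<mu> (mult_op \<mu>)"
    unfolding linear_op_def
  proof (intro conjI allI impI)
    show "mult_op \<mu> \<subseteq> L2 \<mu> \<times> L2 \<mu>"
      by (auto simp: mult_op_def)
    show "(\<lambda>_. 0, \<lambda>_. 0) \<in> mult_op \<mu>"
      by (simp add: mem)
    show "(\<lambda>x. c * f x + f' x, \<lambda>x. c * g x + g' x) \<in> mult_op \<mu>"
      if "(f, g) \<in> mult_op \<mu>" "(f', g') \<in> mult_op \<mu>" for f g f' g' c
      unfolding mem
    proof (intro conjI L2_add L2_cmult)
      have "AE t in \<mu>. g t = complex_of_real t * f t" "AE t in \<mu>. g' t = complex_of_real t * f' t"
        using that by (auto simp: mem)
      then show "AE t in \<mu>. c * g t + g' t = complex_of_real t * (c * f t + f' t)"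
        by eventually_elim (simp add: algebra_simps)
    qed (use that in \<open>auto simp: mem\<close>)
    show "(f', g') \<in> mult_op \<mu>"
      if "(f, g) \<in> mult_op \<mu>" "f' \<in> L2 \<mu>" "g' \<in> L2 \<mu>" "AE x in \<mu>. f x = f' x" "AE x in \<mu>. g x = g' x"
      for f g f' g'
      unfolding mem
    proof (intro conjI that)
      have "AE t in \<mu>. g t = complex_of_real t * f t"
        using that by (auto simp: mem)
      with that(4,5) show "AE t in \<mu>. g' t = complex_of_real t * f' t"
        by eventually_elim simp
    qed
    show "AE x in \<mu>. g x = g' x" if "(f, g) \<in> mult_op \<mu>" "(f, g') \<in> mult_op \<mu>" for f g g'
    proof -
      have "AE t in \<mu>. g t = complex_of_real t * f t" "AE t in \<mu>. g' t = complex_of_real t * f t"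
        using that by (auto simp: mem)
      then show ?thesis by eventually_elim simp
    qed
  qed
  show "op_closure \<mu> (mult_op \<mu>) = mult_op \<mu>"
  proof (intro subset_antisym subrelI)
    fix f g assume "(f, g) \<in> op_closure \<mu> (mult_op \<mu>)"
    then obtain s r where f: "f \<in> L2 \<mu>" and g: "g \<in> L2 \<mu>" and sr: "\<And>n. (s n, r n) \<in> mult_op \<mu>"
      and lims: "L2_tendsto \<mu> s f" and limr: "L2_tendsto \<mu> r g"
      by (auto simp: op_closure_def)
    have s: "s n \<in> L2 \<mu>" and r: "r n \<in> L2 \<mu>" and ae: "AE t in \<mu>. r n t = complex_of_real t * s n t" for n
      using sr by (auto simp: mem)
    \<comment> \<open>Multiplication by t is unbounded. Dividing the relation r = t s by t - i
      leaves two multipliers of modulus at most 1, and limits can be taken on both sides.\<close>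
    let ?m = "\<lambda>t. 1 / (complex_of_real t - \<i>)" and ?k = "\<lambda>t. complex_of_real t / (complex_of_real t - \<i>)"
    have m: "?m \<in> borel_measurable \<mu>" "\<And>t. cmod (?m t) \<le> 1"
      using cmod_resolvent_ge(1) by (measurable, auto simp: norm_divide)
    have k: "?k \<in> borel_measurable \<mu>" "\<And>t. cmod (?k t) \<le> 1"
      using cmod_resolvent_ge cmod_resolvent_ge(1)[THEN less_le_trans[OF zero_less_one]]
      by (measurable, simp add: norm_divide divide_le_eq)
    have "L2_tendsto \<mu> (\<lambda>n t. ?m t * r n t) (\<lambda>t. ?m t * g t)"
      by (rule L2_tendsto_bounded_mult[OF r g limr m])
    moreover have "L2_tendsto \<mu> (\<lambda>n t. ?m t * r n t) (\<lambda>t. ?k t * f t)"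
    proof (rule L2_tendsto_cong_AE[OF _ _ _ _ _ _ L2_tendsto_bounded_mult[OF s f lims k]])
      show "AE t in \<mu>. ?k t * s n t = ?m t * r n t" for n
        using ae[of n] by eventually_elim simp
    qed (rule AE_I2 refl L2_bounded_mult(1)[OF s k] L2_bounded_mult(1)[OF r m] L2_bounded_mult(1)[OF f k])+
    ultimately have "AE t in \<mu>. ?m t * g t = ?k t * f t"
      by (intro L2_tendsto_AE_unique[of "\<lambda>n t. ?m t * r n t"] L2_bounded_mult(1)[OF r m]
          L2_bounded_mult(1)[OF g m] L2_bounded_mult(1)[OF f k])
    then have "AE t in \<mu>. g t = complex_of_real t * f t"
      by eventually_elim (simp add: field_simps)
    with f g show "(f, g) \<in> mult_op \<mu>"
      by (simp add: mem)
  next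
    fix f g assume "(f, g) \<in> mult_op \<mu>"
    then show "(f, g) \<in> op_closure \<mu> (mult_op \<mu>)"
      by (intro op_closure_superset) (auto simp: mem)
  qed
qed

section \<open>Polynomials divided by t - i\<close>

context dense_polynomials
begin

context
  fixes C :: real
  assumes C: "C > 0"
begin

text \<open>Multiplication by \<open>res\<close> is the resolvent of the multiplication operator at
  i, divided by \<open>sqrt C\<close>; the divisor makes the squared modulus of \<open>res\<close>
  the density of \<open>\<nu>\<close>.\<close>

definition res :: "real \<Rightarrow> complex" where
  "res t = 1 / (complex_of_real (sqrt C) * (complex_of_real t - \<i>))"

lemma res_measurable: "res \<in> borel_measurable \<mu>" "(\<lambda>t. complex_of_real t * res t) \<in> borel_measurable \<mu>"
proof -
  note [measurable_cong] = sets_borel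
  show "res \<in> borel_measurable \<mu>" "(\<lambda>t. complex_of_real t * res t) \<in> borel_measurable \<mu>"
    unfolding res_def by measurable
qed

text \<open>The modulus of t - i is at least 1 and at least |t|. Together the bounds say that
  multiplication by \<open>res\<close> maps L2 boundedly into the domain of
  \<open>mult_op \<mu>\<close>.\<close>

lemma cmod_res_le: "cmod (res t) \<le> 1 / sqrt C" "cmod (complex_of_real t * res t) \<le> 1 / sqrt C"
proof -
  define r where "r = cmod (complex_of_real t - \<i>)"
  have r: "1 \<le> r" "\<bar>t\<bar> \<le> r"
    unfolding r_def by (rule cmod_resolvent_ge)+
  have res: "cmod (res t) = 1 / sqrt C * (1 / r)"
    using C by (simp add: res_def norm_divide norm_mult r_def)
  have "1 / sqrt C * (1 / r) \<le> 1 / sqrt C * 1" "1 / sqrt C * (\<bar>t\<bar> / r) \<le> 1 / sqrt C * 1"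
    by (intro mult_left_mono, use C r in \<open>simp_all add: divide_le_eq\<close>)+
  then show "cmod (res t) \<le> 1 / sqrt C" "cmod (complex_of_real t * res t) \<le> 1 / sqrt C"
    by (simp_all add: norm_mult res mult.commute)
qed

lemma res_poly_L2: "(\<lambda>t. res t * poly_real p t) \<in> L2 \<mu>"
  by (rule L2_bounded_mult(1)[OF poly_L2 res_measurable(1) cmod_res_le(1)])

lemma res_poly_mult_op: "(\<lambda>t. res t * poly_real p t, \<lambda>t. complex_of_real t * (res t * poly_real p t)) \<in> mult_op \<mu>"
  using L2_bounded_mult(1)[OF poly_L2 res_measurable(2) cmod_res_le(2)]
  by (simp add: mem_mult_op_iff[OF sets_borel] res_poly_L2 mult.assoc)

text \<open>Since \<open>(M - i) (p / (t - i)) = p\<close> and \<open>(M - i)\<^sup>-\<^sup>1\<close> is bounded, approximating \<open>(M - i) h\<close> by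
  polynomials approximates \<open>h\<close> in the graph norm of the multiplication operator \<open>M\<close>.\<close>

lemma res_poly_core:
  assumes hg: "(h, g) \<in> mult_op \<mu>"
  shows "\<exists>p. L2_tendsto \<mu> (\<lambda>n t. res t * poly_real (p n) t) h \<and>
    L2_tendsto \<mu> (\<lambda>n t. complex_of_real t * (res t * poly_real (p n) t)) g"
proof -
  have h: "h \<in> L2 \<mu>" and g: "g \<in> L2 \<mu>" and ae: "AE t in \<mu>. g t = complex_of_real t * h t"
    using hg by (auto simp: mem_mult_op_iff[OF sets_borel])
  \<comment> \<open>Up to the factor \<open>sqrt C\<close> this is (M - i) h, so \<open>res\<close>
    times \<open>u\<close> gives back \<open>h\<close>, and t times that gives \<open>g\<close>,
    almost everywhere.\<close>
  define u where "u t = complex_of_real (sqrt C) * (g t - \<i> * h t)" for t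
  have u: "u \<in> L2 \<mu>"
    unfolding u_def by (intro L2_cmult L2_diff g h)
  have "\<exists>p. L2_norm \<mu> (\<lambda>t. u t - poly_real p t) < 1 / real (Suc n)" for n
    using u[folded poly_dense] unfolding L2_closure_def by auto
  then obtain p where p: "\<And>n. L2_norm \<mu> (\<lambda>t. u t - poly_real (p n) t) < 1 / real (Suc n)"
    by metis
  have lim: "L2_tendsto \<mu> (\<lambda>n. poly_real (p n)) u"
  proof (rule L2_tendstoI_bound)
    show "L2_norm \<mu> (\<lambda>t. poly_real (p n) t - u t) \<le> 1 / real (Suc n)" for n
      using p[of n] by (subst L2_norm_minus_commute) simp
    show "(\<lambda>n. 1 / real (Suc n)) \<longlonglongrightarrow> 0"
      using LIMSEQ_inverse_real_of_nat by (simp add: inverse_eq_divide)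
  qed
  have eq: "res t * (complex_of_real (sqrt C) * (complex_of_real t * h t - \<i> * h t)) = h t" for t
  proof -
    have "complex_of_real t * h t - \<i> * h t = (complex_of_real t - \<i>) * h t"
      by (simp add: left_diff_distrib)
    then show ?thesis
      using C by (simp add: res_def)
  qed
  have "L2_tendsto \<mu> (\<lambda>n t. res t * poly_real (p n) t) h"
  proof (rule L2_tendsto_cong_AE[OF _ _ _ h _ _ L2_tendsto_bounded_mult[OF poly_L2 u lim res_measurable(1) cmod_res_le(1)]])
    show "AE t in \<mu>. res t * u t = h t"
      using ae by eventually_elim (simp only: u_def eq)
  qed (auto intro: res_poly_L2 L2_bounded_mult(1)[OF u res_measurable(1) cmod_res_le(1)])
  moreover have "L2_tendsto \<mu> (\<lambda>n t. complex_of_real t * res t * poly_real (p n) t) g"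
  proof (rule L2_tendsto_cong_AE[OF _ _ _ g _ _ L2_tendsto_bounded_mult[OF poly_L2 u lim res_measurable(2) cmod_res_le(2)]])
    show "AE t in \<mu>. complex_of_real t * res t * u t = g t"
      using ae by eventually_elim (simp only: u_def mult.assoc eq)
  qed (auto intro: L2_bounded_mult(1)[OF poly_L2 res_measurable(2) cmod_res_le(2)]
      L2_bounded_mult(1)[OF u res_measurable(2) cmod_res_le(2)])
  ultimately show ?thesis
    by (auto simp: mult.assoc)
qed

lemma res_poly_subspace: "L2_subspace \<mu> (range (\<lambda>p t. res t * poly_real p t))"
  unfolding L2_subspace_def
proof (intro conjI ballI allI)
  show "(\<lambda>_. 0) \<in> range (\<lambda>p t. res t * poly_real p t)"
    by (rule range_eqI[of _ _ 0]) simp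
  fix f g c assume "f \<in> range (\<lambda>p t. res t * poly_real p t)" "g \<in> range (\<lambda>p t. res t * poly_real p t)"
  then obtain p r where "f = (\<lambda>t. res t * poly_real p t)" "g = (\<lambda>t. res t * poly_real r t)"
    by auto
  then show "(\<lambda>x. c * f x + g x) \<in> range (\<lambda>p t. res t * poly_real p t)"
    by (intro range_eqI[of _ _ "smult c p + r"]) (simp add: fun_eq_iff algebra_simps)
qed (use res_poly_L2 in auto)

text \<open>The domain of the multiplication operator is dense, by cutting functions off outside
  [-n, n], and every element of the domain is a limit of such quotients.\<close>

lemma res_poly_dense: "L2_closure \<mu> (range (\<lambda>p t. res t * poly_real p t)) = L2 \<mu>"
proof
  let ?V = "range (\<lambda>p t. res t * poly_real p t)"
  show "L2_closure \<mu> ?V \<subseteq> L2 \<mu>"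
    by (auto simp: L2_closure_def)
  have dom: "h \<in> L2_closure \<mu> ?V" if hg: "(h, g) \<in> mult_op \<mu>" for h g
  proof -
    from res_poly_core[OF hg] obtain p where lim: "L2_tendsto \<mu> (\<lambda>n t. res t * poly_real (p n) t) h"
      by (elim exE conjE)
    have "(\<lambda>t. res t * poly_real (p n) t) \<in> L2_closure \<mu> ?V" for n
      by (rule L2_closure_superset[OF res_poly_subspace]) blast
    moreover have "h \<in> L2 \<mu>"
      using hg by (auto simp: mult_op_def)
    ultimately show ?thesis
      using lim by (rule L2_closure_tendsto[OF res_poly_subspace])
  qed
  show "L2 \<mu> \<subseteq> L2_closure \<mu> ?V"
  proof
    fix f assume f: "f \<in> L2 \<mu>"
    define s where "s n t = indicator {- real n..real n} t * f t" for n t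
    have s: "s n \<in> L2 \<mu>" for n
      unfolding s_def using f by (rule L2_indicator_mult) (simp add: sets_borel)
    note [measurable_cong] = sets_borel and [measurable] = L2_measurable[OF s] L2_measurable[OF f]
    have "(\<lambda>t. complex_of_real t * s n t) \<in> L2 \<mu>" for n
    proof (rule L2_bound[OF f, where C = "real n"])
      show "cmod (complex_of_real t * s n t) \<le> real n * cmod (f t)" for t
        by (auto simp: s_def indicator_def norm_mult intro!: mult_right_mono)
    qed measurable
    then have "(s n, \<lambda>t. complex_of_real t * s n t) \<in> mult_op \<mu>" for n
      using s by (simp add: mem_mult_op_iff[OF sets_borel])
    then have "s n \<in> L2_closure \<mu> ?V" for n
      by (rule dom)
    moreover have "L2_tendsto \<mu> s f"
    proof (rule L2_tendsto_dominated[where C = 1])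
      fix t
      have "s n t = f t" if "n \<ge> nat \<lceil>\<bar>t\<bar>\<rceil>" for n
      proof -
        have "\<bar>t\<bar> \<le> real n" using that by linarith
        then show ?thesis by (auto simp: s_def indicator_def)
      qed
      then show "(\<lambda>n. s n t) \<longlonglongrightarrow> f t"
        by (intro tendsto_eventually eventually_sequentiallyI)
      show "cmod (s n t) \<le> 1 * cmod (f t)" for n
        by (simp add: s_def indicator_def)
    qed (use f in auto)
    ultimately show "f \<in> L2_closure \<mu> ?V"
      by (rule L2_closure_tendsto[OF res_poly_subspace _ f])
  qed
qed

section \<open>The weighted measure and its orthonormal polynomials\<close>

abbreviation "\<nu> \<equiv> density \<mu> (\<lambda>x. ennreal (1 / C * (1 / (1 + x\<^sup>2))))"

lemma cmod_res_power2: "(cmod (res t))\<^sup>2 = 1 / C * (1 / (1 + t\<^sup>2))"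
proof -
  have "1 + t\<^sup>2 \<ge> 0" by simp
  then show ?thesis
    using C by (simp add: res_def norm_divide norm_mult cmod_resolvent power_divide power_mult_distrib)
qed

lemma weight_measurable: "(\<lambda>t. 1 / C * (1 / (1 + t\<^sup>2))) \<in> borel_measurable \<mu>"
proof -
  note [measurable_cong] = sets_borel
  show ?thesis by measurable
qed

lemma weight_nonneg: "0 \<le> 1 / C * (1 / (1 + t\<^sup>2))"
  using C by simp

text \<open>The density of \<open>\<nu>\<close> is the squared modulus of \<open>res\<close>, so
  multiplication by \<open>res\<close> carries L2 of \<open>\<nu>\<close> isometrically into L2 of
  \<open>\<mu>\<close>.\<close>

lemma L2_weighted_iff:
  assumes "g \<in> borel_measurable \<mu>"
  shows "g \<in> L2 \<nu> \<longleftrightarrow> (\<lambda>t. res t * g t) \<in> L2 \<mu>"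
proof -
  have 1: "(cmod (res t * g t))\<^sup>2 = (1 / C * (1 / (1 + t\<^sup>2))) *\<^sub>R (cmod (g t))\<^sup>2" for t
    by (simp only: norm_mult power_mult_distrib cmod_res_power2 real_scaleR_def)
  have "(\<lambda>t. (cmod (g t))\<^sup>2) \<in> borel_measurable \<mu>" "(\<lambda>t. res t * g t) \<in> borel_measurable \<mu>"
    using assms res_measurable(1) by (auto intro!: borel_measurable_power borel_measurable_times)
  then show ?thesis
    unfolding L2_def mem_Collect_eq 1 using assms weight_nonneg
    by (subst integrable_density[OF _ weight_measurable]) auto
qed

text \<open>The polarised form of this isometry; it turns orthonormality of \<open>R\<close> into
  that of \<open>f\<close>.\<close>

lemma L2_inner_weighted:
  assumes "f \<in> borel_measurable \<mu>" "g \<in> borel_measurable \<mu>"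
  shows "L2_inner \<nu> f g = L2_inner \<mu> (\<lambda>t. res t * f t) (\<lambda>t. res t * g t)"
proof -
  have "cnj (res t * f t) * (res t * g t) = complex_of_real ((cmod (res t))\<^sup>2) * (cnj (f t) * g t)" for t
    by (simp add: complex_norm_square algebra_simps del: of_real_power)
  then have 1: "cnj (res t * f t) * (res t * g t) = (1 / C * (1 / (1 + t\<^sup>2))) *\<^sub>R (cnj (f t) * g t)" for t
    by (simp only: cmod_res_power2 scaleR_conv_of_real)
  show ?thesis
    unfolding L2_inner_def 1 using assms weight_nonneg
    by (intro integral_density weight_measurable borel_measurable_times borel_measurable_cnj') auto
qed

text \<open>As \<open>R k\<close> has degree \<open>k\<close>, the span of \<open>f\<close> consists
  of all products of \<open>res\<close> with polynomials, which is dense and a core of the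
  multiplication operator. Density gives the basis, the core property gives minimality among closed
  operators.\<close>

lemma gram_schmidt_weighted:
  assumes R: "R = gram_schmidt \<nu> (\<lambda>k t. complex_of_real t ^ k)" and f: "f = (\<lambda>k t. res t * R k t)"
  shows "orthonormal_basis \<mu> f" "basis_of_representation \<mu> f (mult_op \<mu>)"
proof -
  have poly_meas: "poly_real p \<in> borel_measurable \<mu>" for p
    using poly_L2 by (rule L2_measurable)
  have polyL: "poly_real p \<in> L2 \<nu>" for p
    using L2_weighted_iff[OF poly_meas] res_poly_L2 by simp
  \<comment> \<open>As \<open>res\<close> has no zero, a polynomial of norm 0 with respect to
    \<open>\<nu>\<close> vanishes almost everywhere for \<open>\<mu>\<close>.\<close>
  have nz: "L2_norm \<nu> (poly_real p) \<noteq> 0" if "p \<noteq> 0" for p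
  proof
    assume "L2_norm \<nu> (poly_real p) = 0"
    then have "L2_inner \<nu> (poly_real p) (poly_real p) = 0"
      by (simp only: L2_inner_self power_zero_numeral of_real_0)
    then have "L2_inner \<mu> (\<lambda>t. res t * poly_real p t) (\<lambda>t. res t * poly_real p t) = 0"
      by (simp only: L2_inner_weighted[OF poly_meas poly_meas])
    then have "L2_norm \<mu> (\<lambda>t. res t * poly_real p t) = 0"
      by (simp add: L2_inner_self)
    then have "AE t in \<mu>. res t * poly_real p t = 0"
      by (simp add: L2_norm_eq_0_iff[OF res_poly_L2])
    then have "AE t in \<mu>. poly_real p t = 0"
      by eventually_elim (use C in \<open>simp add: res_def\<close>)
    then show False
      using poly_norm[OF that] L2_norm_eq_0_iff[OF poly_L2] by simp
  qed
  have "\<forall>k. \<exists>p. degree p = k \<and> p \<noteq> 0 \<and> R k = poly_real p"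
    using gram_schmidt_monomials(1)[OF nz R] by blast
  then obtain P where P: "\<And>k. degree (P k) = k" "\<And>k. P k \<noteq> 0" "\<And>k. R k = poly_real (P k)"
    by metis
  have mono: "(\<lambda>t. complex_of_real t ^ k) \<in> L2 \<nu>" for k
    using polyL[of "monom 1 k"] by (simp add: poly_monom)
  have R_ortho: "L2_inner \<nu> (R i) (R k) = (if i = k then 1 else 0)" for i k
    using gram_schmidt_orthonormal(2)[OF R mono gram_schmidt_monomials(2)[OF nz R]] .
  have fL: "f k \<in> L2 \<mu>" for k
    unfolding f P(3) by (rule res_poly_L2)
  have f_ortho: "L2_inner \<mu> (f i) (f k) = (if i = k then 1 else 0)" for i k
    using R_ortho[of i k] unfolding f P(3) L2_inner_weighted[OF poly_meas poly_meas] .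
  have span: "\<exists>N a. (\<lambda>t. res t * poly_real p t) = (\<lambda>t. \<Sum>k<N. a k * f k t)" for p
  proof -
    obtain N a where a: "p = (\<Sum>k<N. smult (a k) (P k))"
      using poly_graded_span[OF P(1,2), of p "Suc (degree p)"] by blast
    have "res t * poly_real p t = (\<Sum>k<N. a k * f k t)" for t
    proof -
      have "poly_real p t = (\<Sum>k<N. a k * poly_real (P k) t)"
        using arg_cong[OF a, of "\<lambda>r. poly_real r t"] by (simp add: poly_sum)
      then show ?thesis
        by (simp add: f P(3) sum_distrib_left mult.left_commute)
    qed
    then show ?thesis by blast
  qed
  show basis: "orthonormal_basis \<mu> f"
    unfolding orthonormal_basis_def
  proof (intro conjI allI ballI fL f_ortho)
    fix g assume g: "g \<in> L2 \<mu>"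
    show "L2_tendsto \<mu> (\<lambda>n x. \<Sum>k<n. L2_inner \<mu> (f k) g * f k x) g"
    proof (rule L2_tendsto_fourier[OF fL f_ortho g])
      fix \<epsilon> :: real assume "\<epsilon> > 0"
      then obtain p where p: "L2_norm \<mu> (\<lambda>x. g x - res x * poly_real p x) < \<epsilon>"
        using g[folded res_poly_dense] unfolding L2_closure_def by auto
      obtain N a where Na: "(\<lambda>t. res t * poly_real p t) = (\<lambda>t. \<Sum>k<N. a k * f k t)"
        using span by blast
      have "L2_norm \<mu> (\<lambda>x. g x - (\<Sum>k<N. a k * f k x)) < \<epsilon>"
        using p by (simp only: fun_cong[OF Na])
      then show "\<exists>N a. L2_norm \<mu> (\<lambda>x. g x - (\<Sum>k<N. a k * f k x)) < \<epsilon>"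
        by blast
    qed
  qed
  have f_op: "(f k, \<lambda>t. complex_of_real t * f k t) \<in> mult_op \<mu>" for k
    unfolding f P(3) by (rule res_poly_mult_op)
  show "basis_of_representation \<mu> f (mult_op \<mu>)"
    unfolding basis_of_representation_def
  proof (intro conjI allI impI basis closed_mult_op[OF sets_borel])
    show "f k \<in> Domain (mult_op \<mu>)" for k
      using f_op by blast
    fix B assume B: "closed_op \<mu> B \<and> (\<forall>k. f k \<in> Domain B \<and> B `` {f k} = mult_op \<mu> `` {f k})"
    \<comment> \<open>Equality of the images at \<open>f k\<close> puts this pair into the graph of
      \<open>B\<close>. Linearity then reaches all products of \<open>res\<close> with polynomials,
      and closedness the whole multiplication operator.\<close>
    then have fB: "(f k, \<lambda>t. complex_of_real t * f k t) \<in> B" for k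
      using f_op by blast
    have pB: "(\<lambda>t. res t * poly_real p t, \<lambda>t. complex_of_real t * (res t * poly_real p t)) \<in> B" for p
    proof -
      obtain N a where Na: "(\<lambda>t. res t * poly_real p t) = (\<lambda>t. \<Sum>k<N. a k * f k t)"
        using span by blast
      have "(\<lambda>t. \<Sum>k<N. a k * f k t, \<lambda>t. \<Sum>k<N. a k * (complex_of_real t * f k t)) \<in> B"
        using B fB by (intro linear_op_sum) (auto simp: closed_op_def)
      moreover have "(\<lambda>t. \<Sum>k<N. a k * (complex_of_real t * f k t)) = (\<lambda>t. complex_of_real t * (res t * poly_real p t))"
        by (simp only: fun_cong[OF Na] sum_distrib_left mult.left_commute)
      ultimately show ?thesis
        by (simp only: Na)
    qed
    show "mult_op \<mu> \<subseteq> B"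
    proof (rule subrelI)
      fix h g assume hg: "(h, g) \<in> mult_op \<mu>"
      from res_poly_core[OF this] obtain p where p: "L2_tendsto \<mu> (\<lambda>n t. res t * poly_real (p n) t) h"
        "L2_tendsto \<mu> (\<lambda>n t. complex_of_real t * (res t * poly_real (p n) t)) g"
        by (elim exE conjE)
      have "h \<in> L2 \<mu>" "g \<in> L2 \<mu>"
        using hg by (auto simp: mult_op_def)
      then have "(h, g) \<in> op_closure \<mu> B"
        unfolding op_closure_def using p
        by (intro CollectI case_prodI conjI exI[of _ "\<lambda>n t. res t * poly_real (p n) t"]
            exI[of _ "\<lambda>n t. complex_of_real t * (res t * poly_real (p n) t)"] allI pB) auto
      then show "(h, g) \<in> B"
        using B by (auto simp: closed_op_def)
    qed
  qed
qed

end

text \<open>An integral of 0 would force the positive integrand to vanish almost everywhere, and the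
  constant polynomial 1 would have norm 0.\<close>

lemma integral_weight_pos: "(LINT x|\<mu>. 1 / (1 + x\<^sup>2)) > 0"
proof -
  note [measurable_cong] = sets_borel
  have pos: "1 / (1 + x\<^sup>2) > 0" for x :: real
    by (simp add: add_pos_nonneg)
  have int: "integrable \<mu> (\<lambda>x. 1 / (1 + x\<^sup>2))"
  proof (rule integrable_const_bound[where B = 1])
    show "AE x in \<mu>. norm (1 / (1 + x\<^sup>2)) \<le> 1"
      by (intro AE_I2) (simp add: divide_le_eq_1 add_pos_nonneg)
  qed measurable
  have "(LINT x|\<mu>. 1 / (1 + x\<^sup>2)) \<noteq> 0"
  proof
    assume "(LINT x|\<mu>. 1 / (1 + x\<^sup>2)) = 0"
    then have "AE x in \<mu>. 1 / (1 + x\<^sup>2) = 0"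
      using integral_nonneg_eq_0_iff_AE[OF int] less_imp_le[OF pos] by simp
    then have "AE x in \<mu>. poly_real 1 x = 0"
      by eventually_elim (use pos in \<open>auto simp: less_le\<close>)
    then show False
      using poly_norm[of 1] L2_norm_eq_0_iff[OF poly_L2[of 1]] by simp
  qed
  moreover have "(LINT x|\<mu>. 1 / (1 + x\<^sup>2)) \<ge> 0"
    using pos by (intro Bochner_Integration.integral_nonneg) (simp add: less_imp_le)
  ultimately show ?thesis by (metis order_le_less)
qed

end

theorem proposition4p3:
  fixes q b :: "nat \<Rightarrow> real"
    and Jt :: "nat graph"
    and E :: "real set \<Rightarrow> (nat \<Rightarrow> complex) \<Rightarrow> (nat \<Rightarrow> complex)"
    and \<mu> \<nu> :: "real measure"
    and C :: real
    and R f :: "nat \<Rightarrow> real \<Rightarrow> complex"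
  assumes b_pos: "\<And>k. b k > 0"
    and nonselfadjoint: "\<not> selfadjoint cnt (jacobi_operator q b)"
    and extension: "canonical_sa_extension cnt (jacobi_operator q b) Jt"
    and spectral: "is_spectral_measure cnt Jt E"
    and mu: "\<mu> = spectral_dist cnt E (delta 0)"
    and C: "C = (LINT x|\<mu>. 1 / (1 + x\<^sup>2))"
    and nu: "\<nu> = density \<mu> (\<lambda>x. ennreal (1 / C * (1 / (1 + x\<^sup>2))))"
    and R: "R = gram_schmidt \<nu> (\<lambda>k t. complex_of_real t ^ k)"
    and f: "f = (\<lambda>k t. 1 / (complex_of_real (sqrt C) * (complex_of_real t - \<i>)) * R k t)"
  shows "orthonormal_basis \<mu> f \<and> basis_of_representation \<mu> f (mult_op \<mu>)"
proof -
  interpret dense_polynomials \<mu>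
    unfolding mu by (rule jacobi_dense_polynomials[OF b_pos extension spectral])
  have pos: "C > 0"
    unfolding C by (rule integral_weight_pos)
  have "f = (\<lambda>k t. res C t * R k t)"
    unfolding f res_def[OF pos] ..
  then show ?thesis
    using gram_schmidt_weighted[OF pos R[unfolded nu]] by blast
qed

end
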